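(* Let $G$ be a noncomplete graph of connectivity $k>3$, let $Q$ be a DFS tree of $G$, and set $\mathfrak{S}:=\{V(e):\, e\in E(Q)\}$. (i) If every $\mathfrak{S}$-fragment has cardinality at least $\frac{k-1}{2}$, then $Q$ contains at least one $k$-contractible edge. (ii) If every fragment of $G$ has cardinality at least $\frac{k-1}{2}$, then $Q$ contains at least two $k$-contractible edges.
   Context: All graphs are finite, simple and undirected. $G$ is $k$-connected if $|V(G)|>k$ and $G-T$ is connected for all $T\subseteq V(G)$ with $|T|<k$; the connectivity $\kappa(G)$ is the largest such $k$. An edge $e$ of a $k$-connected graph is $k$-contractible if $G/e$ (identify the endvertices of $e$ and simplify) is $k$-connected. A smallest separating set is a $T\subseteq V(G)$ with $|T|=\kappa(G)$ and $G-T$ disconnected; $\mathfrak{T}(G)$ denotes the set of these. For $T\in\mathfrak{T}(G)$, a $T$-fragment is the union of the vertex sets of at least one but not all components of $G-T$; a fragment is a $T$-fragment for some $T\in\mathfrak{T}(G)$. For a family $\mathfrak{S}$ of vertex subsets, a $T$-fragment $F$ is a $T$-$\mathfrak{S}$-fragment if $S\subseteq T$ for some $S\in\mathfrak{S}$; an $\mathfrak{S}$-fragment is a $T$-$\mathfrak{S}$-fragment for some $T\in\mathfrak{T}(G)$. A DFS tree of $G$ is a spanning tree $Q$ with a prescribed root vertex $r$ such that for every vertex $x$, any two $x$-branches are nonadjacent in $G$, where an $x$-branch is the vertex set of a component of $Q-x$ not containing $r$. *)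

theory Defs
  imports Complex_Main "Graph_Theory.Graph_Theory"
begin

text \<open>
  A finite simple undirected graph is a \<^locale>\<open>pair_graph\<close>: finitely many vertices and a
  loopfree, symmetric set of arcs. An undirected edge is the set of its two endvertices, so that
  an edge e and the set V(e) are the same object.
\<close>

definition edges :: "'a pair_pre_digraph \<Rightarrow> 'a set set" where
  "edges G = {{u, v} |u v. (u, v) \<in> parcs G}"

definition delete_verts :: "'a pair_pre_digraph \<Rightarrow> 'a set \<Rightarrow> ('a, 'a \<times> 'a) pre_digraph" where
  "delete_verts G T = with_proj G \<restriction> (pverts G - T)"

text \<open>In a symmetric digraph the strongly connected components are the ordinary components.\<close>

definition components :: "('a, 'b) pre_digraph \<Rightarrow> 'a set set" where
  "components H = pre_digraph.sccs_verts H"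

text \<open>\<^const>\<open>connected\<close> is false for the null graph. This plays no role here or for
  \<open>smallest_separating_sets\<close>: the deleted sets have fewer than \<open>card (pverts G)\<close> elements.\<close>

definition k_connected :: "nat \<Rightarrow> 'a pair_pre_digraph \<Rightarrow> bool" where
  "k_connected k G \<longleftrightarrow>
     card (pverts G) > k \<and>
     (\<forall>T. T \<subseteq> pverts G \<and> card T < k \<longrightarrow> connected (delete_verts G T))"

definition connectivity :: "'a pair_pre_digraph \<Rightarrow> nat" where
  "connectivity G = (GREATEST k. k_connected k G)"

text \<open>
  The vertices of G/e are the classes of the equivalence relation that identifies the
  endvertices of e. Loops are dropped explicitly; parallel edges merge since arcs are pairs.
\<close>

definition contract_vertex :: "'a set \<Rightarrow> 'a \<Rightarrow> 'a set" where
  "contract_vertex e w = (if w \<in> e then e else {w})"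

definition contract :: "'a pair_pre_digraph \<Rightarrow> 'a set \<Rightarrow> 'a set pair_pre_digraph" where
  "contract G e =
     \<lparr> pverts = contract_vertex e ` pverts G,
       parcs = {(contract_vertex e x, contract_vertex e y) |x y.
                  (x, y) \<in> parcs G \<and> contract_vertex e x \<noteq> contract_vertex e y} \<rparr>"

definition k_contractible :: "nat \<Rightarrow> 'a pair_pre_digraph \<Rightarrow> 'a set \<Rightarrow> bool" where
  "k_contractible k G e \<longleftrightarrow> k_connected k G \<and> e \<in> edges G \<and> k_connected k (contract G e)"

definition smallest_separating_sets :: "'a pair_pre_digraph \<Rightarrow> 'a set set" where
  "smallest_separating_sets G =
     {T. T \<subseteq> pverts G \<and> card T = connectivity G \<and> \<not> connected (delete_verts G T)}"

definition T_fragment :: "'a pair_pre_digraph \<Rightarrow> 'a set \<Rightarrow> 'a set \<Rightarrow> bool" where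
  "T_fragment G T F \<longleftrightarrow>
     T \<in> smallest_separating_sets G \<and>
     (\<exists>\<C>. \<C> \<noteq> {} \<and> \<C> \<subset> components (delete_verts G T) \<and> F = \<Union>\<C>)"

definition fragment :: "'a pair_pre_digraph \<Rightarrow> 'a set \<Rightarrow> bool" where
  "fragment G F \<longleftrightarrow> (\<exists>T. T_fragment G T F)"

definition T_S_fragment ::
  "'a pair_pre_digraph \<Rightarrow> 'a set set \<Rightarrow> 'a set \<Rightarrow> 'a set \<Rightarrow> bool" where
  "T_S_fragment G \<SS> T F \<longleftrightarrow> T_fragment G T F \<and> (\<exists>S\<in>\<SS>. S \<subseteq> T)"

definition S_fragment :: "'a pair_pre_digraph \<Rightarrow> 'a set set \<Rightarrow> 'a set \<Rightarrow> bool" where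
  "S_fragment G \<SS> F \<longleftrightarrow> (\<exists>T. T_S_fragment G \<SS> T F)"

text \<open>
  The notions \<^const>\<open>forest\<close>, \<^const>\<open>tree\<close> and \<^const>\<open>spanning_tree\<close> are about directed cycles; in
  a symmetric digraph they count every edge, traversed back and forth, as a cycle of length 2.
  Undirected cycles are the directed cycles of length at least 3.
\<close>

definition undirected_tree :: "'a pair_pre_digraph \<Rightarrow> bool" where
  "undirected_tree Q \<longleftrightarrow>
     pair_graph Q \<and> connected (with_proj Q) \<and>
     \<not> (\<exists>p. pre_digraph.cycle (with_proj Q) p \<and> length p \<ge> 3)"

definition branches :: "'a pair_pre_digraph \<Rightarrow> 'a \<Rightarrow> 'a \<Rightarrow> 'a set set" where
  "branches Q r x = {B \<in> components (delete_verts Q {x}). r \<notin> B}"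

definition DFS_tree :: "'a pair_pre_digraph \<Rightarrow> 'a pair_pre_digraph \<Rightarrow> 'a \<Rightarrow> bool" where
  "DFS_tree G Q r \<longleftrightarrow>
     undirected_tree Q \<and> spanning (with_proj Q) (with_proj G) \<and> r \<in> pverts Q \<and>
     (\<forall>x\<in>pverts Q. \<forall>A\<in>branches Q r x. \<forall>B\<in>branches Q r x. A \<noteq> B \<longrightarrow>
        \<not> (\<exists>a\<in>A. \<exists>b\<in>B. (a, b) \<in> parcs G))"

end

theory Submission
  imports Defs
begin

text \<open>
  Suppose that all edges of \<open>Q\<close>, with at most one exception \<open>f\<close>, are noncontractible; then each
  of them lies in a smallest separating set. Let \<open>A\<close> be an inclusion-minimal \<open>\<SS>\<close>-fragment that
  avoids \<open>f\<close>. Crossing \<open>N(A)\<close> with a smallest separating set \<open>T\<close> that contains a tree edge \<open>xy\<close>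
  leaving \<open>A\<close>, the lower bound on the sizes of fragments gives \<open>k = 2|A| + 1\<close>, \<open>A \<subseteq> T\<close>,
  \<open>N(A) \<inter> T = {y}\<close>, and \<open>N(A) - y\<close> is halved by \<open>T\<close>. Uncrossing two such sets \<open>T\<close> shows that \<open>y\<close> is
  the same for all tree edges leaving \<open>A\<close>; here \<open>|A| \<ge> 2\<close> is needed, hence \<open>k > 3\<close>.

  Now take a smallest fragment \<open>B\<close> that avoids \<open>f\<close> and whose neighbourhood contains \<open>A \<union> {y}\<close> for
  such an atom \<open>A\<close>. It contains an atom \<open>A2\<close> with exit \<open>y2\<close>; cross \<open>N(B)\<close> with a smallest
  separating set that contains \<open>A2 \<union> {y2}\<close>. If the two sets meet, then \<open>B = A2\<close> and \<open>y2 = y\<close>, so \<open>A\<close> and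
  \<open>A2\<close> are adjacent sets that the tree leaves only through \<open>y\<close>, which is impossible in a DFS tree.
  Otherwise \<open>N(B) = A \<union> {y} \<union> D\<close> for a fragment \<open>D\<close> of size \<open>|A|\<close> adjacent to \<open>A2\<close>, and tree paths from
  \<open>B\<close> to the opposite side of \<open>B\<close> can only pass through \<open>y\<close> or through \<open>y2\<close> and \<open>D\<close>; this
  contradicts that neighbours of branches are ancestors.
\<close>

section \<open>Crossing smallest separating sets\<close>

text \<open>The variables stand for the sizes of the nine cells in which the partitions \<open>A\<close>, \<open>nb A\<close>,
  \<open>opp A\<close> and \<open>B\<close>, \<open>nb B\<close>, \<open>opp B\<close> cross: \<open>a1\<close>, \<open>t\<close>, \<open>a2\<close> for the cells in \<open>nb B\<close>, \<open>b1\<close>, \<open>t\<close>, \<open>b2\<close> for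
  those in \<open>nb A\<close>, and \<open>n11\<close>, \<open>n12\<close>, \<open>n21\<close>, \<open>n22\<close> for the four corners.\<close>

lemma crossing_end_arith:
  fixes k a1 t a2 b1 b2 nA n11 n12 nA' n21 n22 nB nB' :: nat
  assumes eqs: "a1 + t + a2 = k" "b1 + t + b2 = k"
    "nA = n11 + a1 + n12" "nA' = n21 + a2 + n22" "nB = n11 + b1 + n21" "nB' = n12 + b2 + n22"
    and d: "n11 = 0 \<or> k < a1 + t + b1" "n12 = 0 \<or> k < a1 + t + b2"
    "n21 = 0 \<or> k \<le> a2 + t + b1" "n22 = 0 \<or> k \<le> a2 + t + b2"
    and big: "0 < t" "k \<le> 2 * nA + 1" "k \<le> 2 * nA' + 1" "k \<le> 2 * nB + 1" "k \<le> 2 * nB' + 1"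
  shows "n11 = 0 \<and> n12 = 0 \<and> 2 * nA + 1 = k \<and> t = 1 \<and> 2 * b1 + 1 = k \<and> 2 * b2 + 1 = k"
proof -
  \<comment> \<open>The boundaries of two opposite corners have sizes adding up to
    \<open>2 * k\<close>. A corner whose boundary exceeds \<open>k\<close> therefore forces the
    opposite corner to be empty.\<close>
  have n22: "n22 = 0" if h: "k < a1 + t + b1"
    using d(4) by (rule disjE) (use h eqs in linarith)+
  have n21: "n21 = 0" if h: "k < a1 + t + b2"
    using d(3) by (rule disjE) (use h eqs in linarith)+
  have 1: "n11 = 0 \<or> n12 = 0"
  proof (rule ccontr)
    assume "\<not> ?thesis"
    then have h: "k < a1 + t + b1" "k < a1 + t + b2"
      using d by auto
    show False
      using h n22[OF h(1)] n21[OF h(2)] eqs big by linarith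
  qed
  \<comment> \<open>With \<open>n12 = n22 = 0\<close> the opposite side of \<open>B\<close> consists
    of \<open>b2\<close> alone, and \<open>a1 > b2\<close>. Then \<open>a1 + a2\<close> or
    \<open>b1 + b2\<close> is at least \<open>k\<close>, which leaves no room for
    \<open>t > 0\<close>.\<close>
  have 2: "n11 = 0"
  proof (rule ccontr)
    assume "n11 \<noteq> 0"
    then have h: "k < a1 + t + b1" "n12 = 0"
      using d 1 by auto
    show False
      using d(3) by (rule disjE) (use h n22[OF h(1)] eqs big in linarith)+
  qed
  have 3: "n12 = 0"
  proof (rule ccontr)
    assume "n12 \<noteq> 0"
    then have h: "k < a1 + t + b2"
      using d by auto
    show False
      using d(4) by (rule disjE) (use h n21[OF h(1)] 2 eqs big in linarith)+
  qed
  have 4: "k \<le> 2 * b1 + 1"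
    using d(3) by (rule disjE) (use 2 3 eqs big in linarith)+
  have 5: "k \<le> 2 * b2 + 1"
    using d(4) by (rule disjE) (use 2 3 eqs big in linarith)+
  have 6: "2 * b1 + 1 = k" "2 * b2 + 1 = k" "t = 1"
    using 4 5 eqs big by linarith+
  have 7: "2 * a1 + 1 \<le> k"
    using d(3)
  proof
    assume h: "n21 = 0"
    show ?thesis
      using d(4) by (rule disjE) (use h 6 eqs big in linarith)+
  qed (use 6 eqs in linarith)
  show ?thesis
    using 2 3 6 7 eqs big by (intro conjI) linarith+
qed

text \<open>The cells keep their meaning, but \<open>t = 0\<close>. As \<open>a1 > a\<close>, the
  cell \<open>a2\<close> has at most \<open>a\<close> elements, and so has one of \<open>b1\<close>
  and \<open>b2\<close>, which sum to \<open>2 * a + 1\<close>. The corner between the two small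
  cells has a boundary below \<open>k\<close> and is empty; counting also empties the adjacent
  corner inside \<open>A\<close>, so one side of \<open>B\<close> is just its small cell.\<close>

lemma crossing_disjoint_arith:
  fixes k a1 t a2 b1 b2 nA n11 n12 nA' n21 n22 nB nB' a :: nat
  assumes eqs: "a1 + t + a2 = k" "b1 + t + b2 = k"
    "nA = n11 + a1 + n12" "nA' = n21 + a2 + n22" "nB = n11 + b1 + n21" "nB' = n12 + b2 + n22"
    and d: "n11 = 0 \<or> k < a1 + t + b1" "n12 = 0 \<or> k < a1 + t + b2"
    "n21 = 0 \<or> k \<le> a2 + t + b1" "n22 = 0 \<or> k \<le> a2 + t + b2"
    and big: "t = 0" "k \<le> 2 * nA' + 1" "k \<le> 2 * nB + 1" "k \<le> 2 * nB' + 1"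
      "k + 1 \<le> 2 * a1" "k = 2 * a + 1"
  shows "a1 = a + 1 \<and> (n11 = 0 \<and> n21 = 0 \<and> nB = a \<or> n12 = 0 \<and> n22 = 0 \<and> nB' = a)"
proof (cases "b1 \<le> a")
  case True
  have 1: "n21 = 0"
    using d(3) by (rule disjE) (use True eqs big in linarith)+
  have 2: "n11 = 0"
    using d(1)
  proof
    assume h: "k < a1 + t + b1"
    show ?thesis
      using d(4) by (rule disjE) (use h 1 True eqs big in linarith)+
  qed
  have 3: "nB = a"
    using 1 2 eqs big True by linarith
  have "a1 = a + 1"
    using d(4) by (rule disjE) (use 1 2 3 True eqs big in linarith)+
  then show ?thesis
    using 1 2 3 by simp
next
  case False
  have 1: "n22 = 0"
    using d(4) by (rule disjE) (use False eqs big in linarith)+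
  have 2: "n12 = 0"
    using d(2)
  proof
    assume h: "k < a1 + t + b2"
    show ?thesis
      using d(3) by (rule disjE) (use h 1 False eqs big in linarith)+
  qed
  have 3: "nB' = a"
    using 1 2 eqs big False by linarith
  have "a1 = a + 1"
    using d(3) by (rule disjE) (use 1 2 3 False eqs big in linarith)+
  then show ?thesis
    using 1 2 3 by simp
qed

section \<open>Fragments as vertex sets, and the nine cells of a crossing\<close>

locale separated_graph =
  fixes V :: "'a set" and E :: "('a \<times> 'a) set" and k :: nat
  assumes finite_V: "finite V" and E_subset: "E \<subseteq> V \<times> V" and sym_E: "sym E"
begin

definition nb :: "'a set \<Rightarrow> 'a set" where
  "nb X = {v \<in> V - X. \<exists>x\<in>X. (x, v) \<in> E}"

definition opp :: "'a set \<Rightarrow> 'a set" where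
  "opp X = V - X - nb X"

text \<open>The separating set need not be carried along: under \<open>k_le\<close> below, it is
  recovered from the fragment as \<open>nb X\<close>, and \<open>opp X\<close> is the complementary
  fragment.\<close>

definition frag :: "'a set \<Rightarrow> bool" where
  "frag X \<longleftrightarrow> X \<subseteq> V \<and> X \<noteq> {} \<and> opp X \<noteq> {} \<and> card (nb X) = k"

lemma E_sym: "(x, y) \<in> E \<Longrightarrow> (y, x) \<in> E"
  using sym_E by (auto dest: symD)

lemma nb_subset: "nb X \<subseteq> V" and nb_disjoint: "X \<inter> nb X = {}"
  and opp_subset: "opp X \<subseteq> V" and opp_disjoint: "X \<inter> opp X = {}"
  and nb_opp_disjoint: "nb X \<inter> opp X = {}"
  by (auto simp: nb_def opp_def)

lemma nbI: "(x, v) \<in> E \<Longrightarrow> x \<in> X \<Longrightarrow> v \<notin> X \<Longrightarrow> v \<in> nb X"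
  using E_subset by (auto simp: nb_def)

lemma no_edge_opp: "x \<in> X \<Longrightarrow> v \<in> opp X \<Longrightarrow> (x, v) \<notin> E"
  by (auto simp: nb_def opp_def)

lemma split_V: "X \<subseteq> V \<Longrightarrow> v \<in> V \<Longrightarrow> v \<in> X \<or> v \<in> nb X \<or> v \<in> opp X"
  by (auto simp: opp_def)

lemma finite_sub: "X \<subseteq> V \<Longrightarrow> finite X"
  using finite_V finite_subset by blast

lemma card_split:
  assumes "X \<subseteq> V" "Z \<subseteq> V"
  shows "card Z = card (Z \<inter> X) + card (Z \<inter> nb X) + card (Z \<inter> opp X)"
proof -
  have "Z = (Z \<inter> X) \<union> ((Z \<inter> nb X) \<union> (Z \<inter> opp X))"
    using assms by (auto simp: opp_def)
  moreover have "finite (Z \<inter> Y)" for Y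
    using assms finite_sub by blast
  moreover have "(Z \<inter> X) \<inter> ((Z \<inter> nb X) \<union> (Z \<inter> opp X)) = {}" "(Z \<inter> nb X) \<inter> (Z \<inter> opp X) = {}"
    by (auto simp: nb_def opp_def)
  ultimately show ?thesis
    by (metis (no_types, lifting) card_Un_disjoint finite_Un add.assoc)
qed

end

locale k_connected_graph = separated_graph +
  assumes k_le: "X \<subseteq> V \<Longrightarrow> X \<noteq> {} \<Longrightarrow> opp X \<noteq> {} \<Longrightarrow> k \<le> card (nb X)"
begin

text \<open>Every neighbour of \<open>opp X\<close> lies in \<open>nb X\<close>, which has only
  \<open>k\<close> elements, so \<open>k_le\<close> forces equality.\<close>

lemma frag_opp:
  assumes "frag X"
  shows "frag (opp X)" "nb (opp X) = nb X" "opp (opp X) = X"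
proof -
  have X: "X \<subseteq> V" "X \<noteq> {}" "opp X \<noteq> {}" "card (nb X) = k"
    using assms by (auto simp: frag_def)
  have sub: "nb (opp X) \<subseteq> nb X"
    using E_sym by (auto simp: nb_def opp_def)
  then have "X \<subseteq> opp (opp X)"
    using X(1) by (auto simp: opp_def nb_def)
  then have "k \<le> card (nb (opp X))"
    using k_le[OF opp_subset X(3)] X(2) by blast
  then show eq: "nb (opp X) = nb X"
    using sub X(4) finite_sub[OF nb_subset] by (metis card_subset_eq card_mono le_antisym)
  show oo: "opp (opp X) = X"
    using X(1) unfolding opp_def[of "opp X"] eq by (auto simp: opp_def nb_def)
  show "frag (opp X)"
    unfolding frag_def eq oo using X opp_subset by blast
qed

text \<open>The part of \<open>nb A \<union> nb B\<close> that can be adjacent to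
  \<open>A \<inter> B\<close>: the boundary of that corner.\<close>

definition corner :: "'a set \<Rightarrow> 'a set \<Rightarrow> 'a set" where
  "corner A B = (A \<inter> nb B) \<union> (nb A \<inter> nb B) \<union> (nb A \<inter> B)"

lemma card_corner: "card (corner A B) = card (A \<inter> nb B) + card (nb A \<inter> nb B) + card (nb A \<inter> B)"
proof -
  have "finite (nb A)" "finite (nb B)"
    using finite_sub nb_subset by blast+
  moreover have "A \<inter> nb B \<inter> (nb A \<inter> nb B) = {}" "(A \<inter> nb B \<union> nb A \<inter> nb B) \<inter> (nb A \<inter> B) = {}"
    using nb_disjoint by auto
  ultimately show ?thesis
    unfolding corner_def by (simp add: card_Un_disjoint)
qed

text \<open>\<open>nb (A \<inter> B)\<close> lies in the corner boundary and \<open>opp A\<close>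
  lies beyond it, so \<open>k_le\<close> applies. If the boundary has at most \<open>k\<close>
  elements, it must coincide with \<open>nb (A \<inter> B)\<close>.\<close>

lemma corner_frag:
  assumes "frag A" "frag B" "A \<inter> B \<noteq> {}"
  shows "k \<le> card (corner A B)"
    and "card (corner A B) \<le> k \<Longrightarrow> frag (A \<inter> B)"
    and "card (corner A B) \<le> k \<Longrightarrow> nb (A \<inter> B) = corner A B"
proof -
  have sub: "nb (A \<inter> B) \<subseteq> corner A B"
    using E_subset by (auto simp: nb_def corner_def)
  have AV: "A \<inter> B \<subseteq> V"
    using assms by (auto simp: frag_def)
  have "opp A \<subseteq> opp (A \<inter> B)"
    by (auto simp: nb_def opp_def)
  then have ne: "opp (A \<inter> B) \<noteq> {}"
    using assms(1) by (auto simp: frag_def)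
  have ge: "k \<le> card (nb (A \<inter> B))"
    using k_le AV assms(3) ne by blast
  have fin: "finite (corner A B)"
    using finite_sub[OF nb_subset] by (simp add: corner_def)
  show "k \<le> card (corner A B)"
    using ge card_mono[OF fin sub] by linarith
  show eq: "nb (A \<inter> B) = corner A B" if "card (corner A B) \<le> k"
    using card_seteq[OF fin sub] ge that by linarith
  show "frag (A \<inter> B)" if "card (corner A B) \<le> k"
    unfolding frag_def using eq[OF that] ge that AV ne assms(3) by simp
qed

text \<open>Submodularity: the boundaries of the two opposite corners have total size
  \<open>2 * k\<close>, and that of \<open>opp A \<inter> opp B\<close> is at least
  \<open>k\<close>.\<close>

lemma uncross:
  assumes A: "frag A" and B: "frag B" and ne: "A \<inter> B \<noteq> {}" "opp A \<inter> opp B \<noteq> {}"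
  shows "frag (A \<inter> B)" "nb (A \<inter> B) = corner A B"
proof -
  have AB: "A \<subseteq> V" "B \<subseteq> V" "card (nb A) = k" "card (nb B) = k"
    using A B by (auto simp: frag_def)
  have 1: "k \<le> card (corner (opp A) (opp B))"
    using corner_frag(1) frag_opp(1) A B ne(2) by blast
  have 2: "card (corner (opp A) (opp B)) = card (opp A \<inter> nb B) + card (nb A \<inter> nb B) + card (nb A \<inter> opp B)"
    unfolding card_corner using frag_opp(2) A B by simp
  have 3: "k = card (nb A \<inter> B) + card (nb A \<inter> nb B) + card (nb A \<inter> opp B)"
    using card_split[OF AB(2) nb_subset, of A] AB by simp
  have 4: "k = card (A \<inter> nb B) + card (nb A \<inter> nb B) + card (opp A \<inter> nb B)"
    using card_split[OF AB(1) nb_subset, of B] AB by (simp add: Int_commute)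
  have "card (corner A B) \<le> k"
    using 1 2 3 4 card_corner[of A B] by linarith
  then show "frag (A \<inter> B)" "nb (A \<inter> B) = corner A B"
    using corner_frag[OF A B ne(1)] by auto
qed

text \<open>Provides the hypotheses of the counting lemmas. The bounds for the corners inside
  \<open>A\<close> are strict because of \<open>no\<close>; those inside \<open>opp A\<close> are
  not.\<close>

lemma crossing_counts:
  assumes A: "frag A" and B: "frag B"
    and no: "\<not> (frag (A \<inter> B) \<and> nb (A \<inter> B) = corner A B)"
      "\<not> (frag (A \<inter> opp B) \<and> nb (A \<inter> opp B) = corner A (opp B))"
  shows "card (A \<inter> nb B) + card (nb A \<inter> nb B) + card (opp A \<inter> nb B) = k"
    and "card (nb A \<inter> B) + card (nb A \<inter> nb B) + card (nb A \<inter> opp B) = k"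
    and "card A = card (A \<inter> B) + card (A \<inter> nb B) + card (A \<inter> opp B)"
    and "card (opp A) = card (opp A \<inter> B) + card (opp A \<inter> nb B) + card (opp A \<inter> opp B)"
    and "card B = card (A \<inter> B) + card (nb A \<inter> B) + card (opp A \<inter> B)"
    and "card (opp B) = card (A \<inter> opp B) + card (nb A \<inter> opp B) + card (opp A \<inter> opp B)"
    and "card (A \<inter> B) = 0 \<or> k < card (A \<inter> nb B) + card (nb A \<inter> nb B) + card (nb A \<inter> B)"
    and "card (A \<inter> opp B) = 0 \<or> k < card (A \<inter> nb B) + card (nb A \<inter> nb B) + card (nb A \<inter> opp B)"
    and "card (opp A \<inter> B) = 0 \<or> k \<le> card (opp A \<inter> nb B) + card (nb A \<inter> nb B) + card (nb A \<inter> B)"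
    and "card (opp A \<inter> opp B) = 0 \<or> k \<le> card (opp A \<inter> nb B) + card (nb A \<inter> nb B) + card (nb A \<inter> opp B)"
proof -
  have AB: "A \<subseteq> V" "B \<subseteq> V" "card (nb A) = k" "card (nb B) = k"
    using A B by (auto simp: frag_def)
  note opp = frag_opp[OF A] frag_opp[OF B]
  show "card (nb A \<inter> B) + card (nb A \<inter> nb B) + card (nb A \<inter> opp B) = k"
    using card_split[OF AB(2) nb_subset, of A] AB by simp
  show "card (A \<inter> nb B) + card (nb A \<inter> nb B) + card (opp A \<inter> nb B) = k"
    using card_split[OF AB(1) nb_subset, of B] AB by (simp add: Int_commute)
  show "card A = card (A \<inter> B) + card (A \<inter> nb B) + card (A \<inter> opp B)"
    using card_split[OF AB(2) AB(1)] .
  show "card (opp A) = card (opp A \<inter> B) + card (opp A \<inter> nb B) + card (opp A \<inter> opp B)"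
    using card_split[OF AB(2) opp_subset] .
  show "card B = card (A \<inter> B) + card (nb A \<inter> B) + card (opp A \<inter> B)"
    using card_split[OF AB(1) AB(2)] by (simp add: Int_commute)
  show "card (opp B) = card (A \<inter> opp B) + card (nb A \<inter> opp B) + card (opp A \<inter> opp B)"
    using card_split[OF AB(1) opp_subset, of B] by (simp add: Int_commute)
  have fin: "finite A"
    using AB finite_sub by blast
  have *: "card (A \<inter> C) = 0 \<or> k < card (corner A C)" if "C = B \<or> C = opp B" for C
    using corner_frag[OF A, of C] no that B opp fin by (metis card.empty not_less)
  show "card (A \<inter> B) = 0 \<or> k < card (A \<inter> nb B) + card (nb A \<inter> nb B) + card (nb A \<inter> B)"
    using *[of B] by (simp add: card_corner)
  show "card (A \<inter> opp B) = 0 \<or> k < card (A \<inter> nb B) + card (nb A \<inter> nb B) + card (nb A \<inter> opp B)"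
    using *[of "opp B"] by (simp add: card_corner opp)
  have **: "card (opp A \<inter> C) = 0 \<or> k \<le> card (corner (opp A) C)" if "frag C" for C
    using corner_frag(1)[OF opp(1) that] by (metis card.empty)
  show "card (opp A \<inter> B) = 0 \<or> k \<le> card (opp A \<inter> nb B) + card (nb A \<inter> nb B) + card (nb A \<inter> B)"
    using **[OF B] by (simp add: card_corner opp)
  show "card (opp A \<inter> opp B) = 0 \<or> k \<le> card (opp A \<inter> nb B) + card (nb A \<inter> nb B) + card (nb A \<inter> opp B)"
    using **[OF opp(4)] by (simp add: card_corner opp)
qed

text \<open>The hypothesis \<open>no\<close> is the form in which minimality of \<open>A\<close>
  enters: nonempty corners inside \<open>A\<close> must have boundaries larger than
  \<open>k\<close>, and the size bounds exclude this.\<close>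

lemma crossing_end:
  assumes A: "frag A" and B: "frag B"
    and no: "\<not> (frag (A \<inter> B) \<and> nb (A \<inter> B) = corner A B)"
      "\<not> (frag (A \<inter> opp B) \<and> nb (A \<inter> opp B) = corner A (opp B))"
    and big: "k \<le> 2 * card A + 1" "k \<le> 2 * card (opp A) + 1" "k \<le> 2 * card B + 1"
      "k \<le> 2 * card (opp B) + 1"
    and ne: "nb A \<inter> nb B \<noteq> {}"
  shows "2 * card A + 1 = k" "A \<subseteq> nb B" "card (nb A \<inter> nb B) = 1"
    "2 * card (nb A \<inter> B) + 1 = k" "2 * card (nb A \<inter> opp B) + 1 = k"
proof -
  note c = crossing_counts[OF A B no]
  have t: "card (nb A \<inter> nb B) > 0"
    using ne finite_sub[OF nb_subset] by (simp add: card_gt_0_iff)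
  have main: "card (A \<inter> B) = 0 \<and> card (A \<inter> opp B) = 0 \<and> 2 * card A + 1 = k \<and> card (nb A \<inter> nb B) = 1 \<and>
    2 * card (nb A \<inter> B) + 1 = k \<and> 2 * card (nb A \<inter> opp B) + 1 = k"
    by (rule crossing_end_arith[OF c t big])
  then show "2 * card A + 1 = k" "card (nb A \<inter> nb B) = 1"
    "2 * card (nb A \<inter> B) + 1 = k" "2 * card (nb A \<inter> opp B) + 1 = k"
    by auto
  have "A \<subseteq> V" "B \<subseteq> V"
    using A B by (auto simp: frag_def)
  then have "finite A" using finite_sub by blast
  then have "A \<inter> B = {}" "A \<inter> opp B = {}"
    using main by auto
  then show "A \<subseteq> nb B"
    using split_V[OF \<open>B \<subseteq> V\<close>] \<open>A \<subseteq> V\<close> by blast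
qed

text \<open>A side of \<open>B\<close> that misses both \<open>A\<close> and \<open>opp A\<close>
  has nowhere to go but \<open>nb A\<close>.\<close>

lemma crossing_disjoint:
  assumes A: "frag A" and B: "frag B"
    and no: "\<not> (frag (A \<inter> B) \<and> nb (A \<inter> B) = corner A B)"
      "\<not> (frag (A \<inter> opp B) \<and> nb (A \<inter> opp B) = corner A (opp B))"
    and big: "k \<le> 2 * card (opp A) + 1" "k \<le> 2 * card B + 1" "k \<le> 2 * card (opp B) + 1"
    and disj: "nb A \<inter> nb B = {}" and ge: "k + 1 \<le> 2 * card (A \<inter> nb B)" and odd: "k = 2 * a + 1"
  obtains D where "D = B \<or> D = opp B" "D \<subseteq> nb A" "card D = a" "card (A \<inter> nb B) = a + 1"
proof -
  note c = crossing_counts[OF A B no]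
  have t: "card (nb A \<inter> nb B) = 0"
    using disj by simp
  have main: "card (A \<inter> nb B) = a + 1 \<and>
     (card (A \<inter> B) = 0 \<and> card (opp A \<inter> B) = 0 \<and> card B = a \<or>
      card (A \<inter> opp B) = 0 \<and> card (opp A \<inter> opp B) = 0 \<and> card (opp B) = a)"
    using crossing_disjoint_arith[OF c t big ge odd] .
  have fin: "finite (A \<inter> X)" "finite (opp A \<inter> X)" for X
    using A finite_sub opp_subset by (auto simp: frag_def)
  have AV: "A \<subseteq> V" "B \<subseteq> V"
    using A B by (auto simp: frag_def)
  have sub: "X \<subseteq> nb A" if "card (A \<inter> X) = 0" "card (opp A \<inter> X) = 0" "X \<subseteq> V" for X
  proof -
    have "A \<inter> X = {}" "opp A \<inter> X = {}"
      using that(1,2) fin by auto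
    then show ?thesis
      using split_V[OF AV(1)] that(3) by blast
  qed
  show ?thesis
    using main that[of B] that[of "opp B"] sub AV opp_subset by blast
qed

end

section \<open>Root paths in DFS trees\<close>

definition walk :: "('a \<times> 'a) set \<Rightarrow> 'a list \<Rightarrow> bool" where
  "walk R p \<longleftrightarrow> successively (\<lambda>u v. (u, v) \<in> R) p"

lemma walk_append: "walk R (p @ q) \<longleftrightarrow> walk R p \<and> walk R q \<and> (p = [] \<or> q = [] \<or> (last p, hd q) \<in> R)"
  by (auto simp: walk_def successively_append_iff)

lemma path_exists:
  assumes "(u, v) \<in> R\<^sup>*"
  shows "\<exists>p. p \<noteq> [] \<and> hd p = u \<and> last p = v \<and> distinct p \<and> walk R p"
  using assms
proof induction
  case base
  show ?case
    by (rule exI[of _ "[u]"]) (simp add: walk_def)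
next
  case (step y z)
  then obtain p where p: "p \<noteq> []" "hd p = u" "last p = y" "distinct p" "walk R p"
    by auto
  show ?case
  proof (cases "z \<in> set p")
    case True
    then obtain p1 p2 where s: "p = p1 @ z # p2"
      by (meson split_list)
    have "walk R ((p1 @ [z]) @ p2)"
      using p(5) s by simp
    then have "walk R (p1 @ [z])"
      by (simp only: walk_append)
    then show ?thesis
      using p s by (intro exI[of _ "p1 @ [z]"]) (auto simp: hd_append)
  next
    case False
    then show ?thesis
      using p step by (intro exI[of _ "p @ [z]"]) (auto simp: walk_def successively_append_iff)
  qed
qed

lemma walk_const:
  assumes "walk R p" "\<And>u v. u \<in> set p \<Longrightarrow> v \<in> set p \<Longrightarrow> (u, v) \<in> R \<Longrightarrow> u \<in> X \<longleftrightarrow> v \<in> X"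
    and "x \<in> set p" "x \<in> X"
  shows "set p \<subseteq> X"
proof -
  have "hd q \<in> X \<longleftrightarrow> z \<in> X" if "z \<in> set q" "walk R q" "set q \<subseteq> set p" for q z
    using that
  proof (induction q)
    case (Cons w q)
    show ?case
    proof (cases "z = w")
      case False
      then have q: "q \<noteq> []" "z \<in> set q"
        using Cons.prems by auto
      then have "(w, hd q) \<in> R" "walk R q"
        using Cons.prems(2) by (auto simp: walk_def successively_Cons)
      moreover have "hd q \<in> set p"
        using Cons.prems(3) hd_in_set[OF q(1)] by auto
      ultimately show ?thesis
        using Cons.IH[OF q(2)] Cons.prems(3) assms(2)[of w "hd q"] by auto
    qed simp
  qed simp
  then show ?thesis
    using assms by blast
qed

text \<open>\<open>(avoid R x)\<^sup>*\<close> is reachability after deletion of \<open>x\<close>,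
  except that by reflexivity it still relates \<open>x\<close> to itself.\<close>

definition avoid :: "('a \<times> 'a) set \<Rightarrow> 'a \<Rightarrow> ('a \<times> 'a) set" where
  "avoid R x = {(u, v) \<in> R. u \<noteq> x \<and> v \<noteq> x}"

lemma walk_avoid:
  assumes "walk R p" "sym R" "x \<notin> set p" "u \<in> set p" "v \<in> set p"
  shows "(u, v) \<in> (avoid R x)\<^sup>*"
proof -
  have "set p \<subseteq> {z. (u, z) \<in> (avoid R x)\<^sup>*}"
  proof (rule walk_const[OF assms(1) _ assms(4)])
    fix w z assume *: "w \<in> set p" "z \<in> set p" "(w, z) \<in> R"
    then have "(w, z) \<in> avoid R x" "(z, w) \<in> avoid R x"
      using assms(2,3) by (auto simp: avoid_def dest: symD)
    then show "w \<in> {z. (u, z) \<in> (avoid R x)\<^sup>*} \<longleftrightarrow> z \<in> {z. (u, z) \<in> (avoid R x)\<^sup>*}"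
      by (auto intro: rtrancl_into_rtrancl)
  qed simp
  then show ?thesis
    using assms by auto
qed

lemma avoid_rtrancl_sym:
  assumes "sym R" "(u, v) \<in> (avoid R x)\<^sup>*"
  shows "(v, u) \<in> (avoid R x)\<^sup>*"
proof -
  have "sym (avoid R x)"
    using assms(1) by (auto simp: avoid_def sym_def)
  then show ?thesis
    using assms(2) sym_rtrancl symD by metis
qed

lemma avoid_rtrancl_eq: "(u, x) \<in> (avoid R x)\<^sup>* \<Longrightarrow> u = x"
  by (erule rtranclE) (auto simp: avoid_def)

lemma rtrancl_exit:
  assumes "(u, v) \<in> R\<^sup>*" "u \<in> A" "v \<notin> A"
  obtains x y where "x \<in> A" "y \<notin> A" "(x, y) \<in> R"
  using assms by (induction rule: rtrancl_induct) auto

text \<open>Acyclicity enters as \<open>tree\<close>: distinct neighbours of \<open>x\<close> lie in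
  different components of \<open>Q - x\<close>. The three reachability conditions in
  \<open>dfs\<close> say that \<open>a\<close> and \<open>b\<close> lie in different
  \<open>x\<close>-branches; for \<open>x = r\<close> the two about \<open>r\<close> hold
  automatically.\<close>

locale dfs_graph = separated_graph V E k for V :: "'a set" and E k +
  fixes Q :: "('a \<times> 'a) set" and r :: 'a
  assumes Q_subset: "Q \<subseteq> E" and sym_Q: "sym Q" and irrefl_Q: "(x, x) \<notin> Q"
    and Q_conn: "u \<in> V \<Longrightarrow> v \<in> V \<Longrightarrow> (u, v) \<in> Q\<^sup>*" and r_in: "r \<in> V"
    and tree: "(x, z) \<in> Q \<Longrightarrow> (x, z') \<in> Q \<Longrightarrow> (z, z') \<in> (avoid Q x)\<^sup>* \<Longrightarrow> z = z'"
    and dfs: "x \<in> V \<Longrightarrow> a \<noteq> x \<Longrightarrow> b \<noteq> x \<Longrightarrow> (a, r) \<notin> (avoid Q x)\<^sup>* \<Longrightarrow>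
      (b, r) \<notin> (avoid Q x)\<^sup>* \<Longrightarrow> (a, b) \<notin> (avoid Q x)\<^sup>* \<Longrightarrow> (a, b) \<notin> E"
begin

lemma Q_sym: "(x, y) \<in> Q \<Longrightarrow> (y, x) \<in> Q"
  using sym_Q by (auto dest: symD)

lemma Q_V: "(x, y) \<in> Q \<Longrightarrow> x \<in> V \<and> y \<in> V"
  using Q_subset E_subset by auto

lemma exit_exists:
  assumes "A \<subseteq> V" "A \<noteq> {}" "A \<noteq> V"
  obtains x y where "x \<in> A" "y \<notin> A" "(x, y) \<in> Q"
proof -
  obtain u v where "u \<in> A" "v \<in> V - A"
    using assms by blast
  then show ?thesis
    using rtrancl_exit[of u v Q A] Q_conn that assms by blast
qed

definition only_exit :: "'a set \<Rightarrow> 'a \<Rightarrow> bool" where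
  "only_exit A y \<longleftrightarrow> A \<subseteq> V \<and> y \<in> V - A \<and> (\<forall>u v. u \<in> A \<longrightarrow> v \<notin> A \<longrightarrow> (u, v) \<in> Q \<longrightarrow> v = y)"

lemma only_exitD: "only_exit A y \<Longrightarrow> (u, v) \<in> Q \<Longrightarrow> u \<in> A \<Longrightarrow> v \<notin> A \<Longrightarrow> v = y"
  by (auto simp: only_exit_def)

lemma only_exit_avoid:
  assumes "only_exit A y" "(a, b) \<in> (avoid Q y)\<^sup>*" "a \<in> A"
  shows "b \<in> A"
  using assms(2,3)
  by (induction rule: rtrancl_induct) (use assms(1) in \<open>auto simp: avoid_def dest: only_exitD\<close>)

lemma only_exit_walk:
  assumes "only_exit A y" "walk Q p" "y \<notin> set p" "x \<in> set p" "x \<in> A"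
  shows "set p \<subseteq> A"
  using walk_const[OF assms(2) _ assms(4,5)] assms(1,3) only_exitD Q_sym by metis

definition root_path :: "'a list \<Rightarrow> 'a \<Rightarrow> bool" where
  "root_path p y \<longleftrightarrow> p \<noteq> [] \<and> hd p = r \<and> last p = y \<and> distinct p \<and> walk Q p"

lemma root_path_exists: "y \<in> V \<Longrightarrow> \<exists>p. root_path p y"
  using path_exists[OF Q_conn[OF r_in]] by (auto simp: root_path_def)

text \<open>If \<open>r \<notin> A\<close> then \<^term>\<open>only_exit A y\<close> says that \<open>A\<close> is a union of \<open>y\<close>-branches, so its
  neighbours are ancestors. The proof compares \<open>a\<close> and \<open>b\<close> at the vertex \<open>x\<close> where the tree path
  from \<open>b\<close> meets the root path.\<close>

lemma neighbours_on_root_path: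
  assumes A: "only_exit A y" "r \<notin> A" and p: "root_path p y"
    and ab: "a \<in> A" "b \<notin> A" "(a, b) \<in> E"
  shows "b \<in> set p"
proof (rule ccontr)
  assume b: "b \<notin> set p"
  have V: "a \<in> V" "b \<in> V" "y \<in> V" "y \<notin> A"
    using ab E_subset A by (auto simp: only_exit_def)
  have p': "p \<noteq> []" "hd p = r" "last p = y" "distinct p" "walk Q p"
    using p by (auto simp: root_path_def)
  have rp: "r \<in> set p" and yp: "y \<in> set p"
    using p' by auto
  obtain q where q: "q \<noteq> []" "hd q = b" "last q = y" "walk Q q"
    using path_exists[OF Q_conn[OF V(2,3)]] by auto
  have "y \<in> set q"
    using q by auto
  \<comment> \<open>\<open>x\<close> is the first vertex of the root path on the way from
    \<open>b\<close>. Its predecessor, named \<open>x'\<close> below, is a neighbour of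
    \<open>x\<close> off the root path.\<close>
  then obtain q1 x q2 where s: "q = q1 @ x # q2" "x \<in> set p" "\<forall>z\<in>set q1. z \<notin> set p"
    using split_list_first_prop[of q "\<lambda>z. z \<in> set p"] yp by blast
  have q1: "q1 \<noteq> []" "b \<in> set q1"
    using s q b by (cases q1; auto)+
  define x' where "x' = last q1"
  have x': "x' \<in> set q1" "(x, x') \<in> Q" "x' \<notin> set p" "walk Q q1"
    using q(4) s q1 Q_sym by (auto simp: x'_def walk_append)
  have bx': "(b, x') \<in> (avoid Q x)\<^sup>*"
    using walk_avoid[OF x'(4) sym_Q _ q1(2) x'(1)] s by blast
  have x: "x \<in> V" "b \<noteq> x"
    using Q_V x'(2) s b by auto
  have sym: "(u, v) \<in> (avoid Q x)\<^sup>* \<Longrightarrow> (v, u) \<in> (avoid Q x)\<^sup>*" for u v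
    by (rule avoid_rtrancl_sym[OF sym_Q])
  obtain p1 p2 where sp: "p = p1 @ x # p2"
    using s by (meson split_list)
  have w: "walk Q p1" "walk Q (x # p2)" "p1 \<noteq> [] \<Longrightarrow> (last p1, x) \<in> Q"
    using p'(5) sp by (auto simp: walk_append)
  have w2: "walk Q p2" "p2 \<noteq> [] \<Longrightarrow> (x, hd p2) \<in> Q"
    using w(2) by (cases p2; simp add: walk_def)+
  have nx: "x \<notin> set p1" "x \<notin> set p2"
    using p' sp by auto
  have r_reach: "x = r \<or> (p1 \<noteq> [] \<and> (r, last p1) \<in> (avoid Q x)\<^sup>* \<and> (x, last p1) \<in> Q)"
  proof (cases "p1 = []")
    case False
    then have "r \<in> set p1" "last p1 \<in> set p1"
      using p' sp by (auto simp: hd_append)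
    then show ?thesis
      using False w Q_sym walk_avoid[OF w(1) sym_Q nx(1)] by blast
  qed (use p' sp in auto)
  \<comment> \<open>Otherwise the neighbours \<open>x'\<close> and \<open>last p1\<close> of
    \<open>x\<close> would lie in one component of \<open>Q - x\<close> and coincide, although only
    the latter is on the root path.\<close>
  have br: "(b, r) \<notin> (avoid Q x)\<^sup>*"
  proof
    assume h: "(b, r) \<in> (avoid Q x)\<^sup>*"
    then have "x \<noteq> r"
      using avoid_rtrancl_eq x(2) by metis
    then have l: "p1 \<noteq> []" "(r, last p1) \<in> (avoid Q x)\<^sup>*" "(x, last p1) \<in> Q"
      using r_reach by auto
    have "(x', last p1) \<in> (avoid Q x)\<^sup>*"
      using sym[OF bx'] h l(2) by (meson rtrancl_trans)
    then have "x' = last p1"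
      using tree x'(2) l(3) by blast
    then show False
      using x'(3) sp l(1) by auto
  qed
  show False
  proof (cases "x = y")
    case True
    have "(a, r) \<notin> (avoid Q x)\<^sup>*" "(a, b) \<notin> (avoid Q x)\<^sup>*"
      using only_exit_avoid[OF A(1)] True ab A(2) by blast+
    moreover have "a \<noteq> x"
      using True ab V by blast
    ultimately show False
      using dfs[OF x(1) _ x(2) _ br] ab by blast
  next
    \<comment> \<open>Now \<open>x\<close> precedes \<open>y\<close> on the root path. Its
      neighbours \<open>last p1\<close> (if \<open>x \<noteq> r\<close>), \<open>hd p2\<close> and
      \<open>x'\<close> lead to \<open>r\<close>, \<open>y\<close> and \<open>b\<close>, and
      \<open>tree\<close> keeps their components apart. It remains to place \<open>a\<close> in the
      component of \<open>hd p2\<close>.\<close>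
    case False
    then have p2: "p2 \<noteq> []" "y \<in> set p2" "hd p2 \<in> set p2"
      using p' sp by (auto simp: last_append split: if_splits)
    obtain p0 where p0: "p = p0 @ [y]"
      using p'(1,3) append_butlast_last_id[of p] by metis
    then have p0': "walk Q p0" "y \<notin> set p0"
      using p'(4,5) by (auto simp: walk_append)
    have xp0: "x \<in> set p0" "r \<in> set p0"
      using s(2) p0 False p' by (auto simp: hd_append split: if_splits)
    have xA: "x \<notin> A"
      using only_exit_walk[OF A(1) p0' xp0(1)] xp0(2) A(2) by blast
    obtain t where t: "t \<noteq> []" "hd t = a" "last t = y" "walk Q t"
      using path_exists[OF Q_conn[OF V(1,3)]] by auto
    have "y \<in> set t"
      using t by auto
    \<comment> \<open>The walk from \<open>a\<close> first leaves \<open>A\<close> at its only exit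
      \<open>y\<close>. Up to there it misses \<open>x\<close>, which is outside
      \<open>A\<close>.\<close>
    then obtain t1 z t2 where st: "t = t1 @ z # t2" "z \<notin> A" "\<forall>z\<in>set t1. z \<in> A"
      using split_list_first_prop[of t "\<lambda>z. z \<notin> A"] V(4) by blast
    have t1: "t1 \<noteq> []" "a \<in> set t1"
      using st t ab by (cases t1; auto)+
    have "(last t1, z) \<in> Q" and wt: "walk Q (t1 @ [z])"
      using t(4) st t1 by (auto simp: walk_append) (auto simp: walk_def)?
    then have zy: "z = y"
      using only_exitD[OF A(1)] st t1 by auto
    have ay: "(a, y) \<in> (avoid Q x)\<^sup>*"
      by (rule walk_avoid[OF wt sym_Q]) (use st t1 zy False xA in auto)
    have yh: "(y, hd p2) \<in> (avoid Q x)\<^sup>*"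
      using walk_avoid[OF w2(1) sym_Q nx(2) p2(2,3)] .
    have ah: "(a, hd p2) \<in> (avoid Q x)\<^sup>*"
      using ay yh by simp
    have xh: "(x, hd p2) \<in> Q"
      using w2 p2 by blast
    have "(a, b) \<notin> (avoid Q x)\<^sup>*"
    proof
      assume "(a, b) \<in> (avoid Q x)\<^sup>*"
      then have "(hd p2, x') \<in> (avoid Q x)\<^sup>*"
        using sym[OF ah] bx' by (meson rtrancl_trans)
      then have "hd p2 = x'"
        using tree xh x'(2) by blast
      then show False
        using x'(3) sp p2(3) by auto
    qed
    moreover have "(a, r) \<notin> (avoid Q x)\<^sup>*"
    proof
      assume h: "(a, r) \<in> (avoid Q x)\<^sup>*"
      then have "x \<noteq> r"
        using avoid_rtrancl_eq xA ab by metis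
      then have l: "p1 \<noteq> []" "(r, last p1) \<in> (avoid Q x)\<^sup>*" "(x, last p1) \<in> Q"
        using r_reach by auto
      have "(hd p2, last p1) \<in> (avoid Q x)\<^sup>*"
        using sym[OF ah] h l(2) by (meson rtrancl_trans)
      then have "hd p2 = last p1"
        using tree xh l(3) by blast
      then show False
        using p'(4) sp l(1) p2(3) by auto (metis disjoint_iff last_in_set)
    qed
    moreover have "a \<noteq> x"
      using ab xA by blast
    ultimately show False
      using dfs[OF x(1) _ x(2) _ br] ab by blast
  qed
qed

end

section \<open>Atoms and their tree exits\<close>

text \<open>\<open>S\<close> consists of the tree arcs covered by smallest separating sets, that is, of the
  noncontractible ones, and \<open>U\<close> is the vertex set of the only contractible tree edge, or empty if
  there is none. In the first part of the theorem \<open>U\<close> is empty, and \<open>big_all\<close> is void.\<close>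

locale covered_dfs_tree =
  k_connected_graph V E k + dfs_graph V E k Q r
  for V :: "'a set" and E k Q r +
  fixes S :: "('a \<times> 'a) set" and U :: "'a set"
  assumes k_gt: "3 < k" and card_V: "2 < card V"
    and S_subset: "S \<subseteq> Q" and not_S: "(x, y) \<in> Q \<Longrightarrow> (x, y) \<notin> S \<Longrightarrow> U = {x, y}"
    and U_edge: "U = {} \<or> (\<exists>u w. U = {u, w} \<and> (u, w) \<in> E)"
    and S_sep: "(x, y) \<in> S \<Longrightarrow> \<exists>X. frag X \<and> x \<in> nb X \<and> y \<in> nb X"
    and big_S: "frag X \<Longrightarrow> (x, y) \<in> S \<Longrightarrow> x \<in> nb X \<Longrightarrow> y \<in> nb X \<Longrightarrow> k \<le> 2 * card X + 1"
    and big_all: "U \<noteq> {} \<Longrightarrow> frag X \<Longrightarrow> k \<le> 2 * card X + 1"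
begin

definition sfrag :: "'a set \<Rightarrow> bool" where
  "sfrag X \<longleftrightarrow> frag X \<and> (\<exists>x y. (x, y) \<in> S \<and> x \<in> nb X \<and> y \<in> nb X)"

text \<open>By \<open>sfrag_big\<close> this is the least size an \<open>sfrag\<close> can have, so
  atoms are automatically inclusion-minimal.\<close>

definition atom :: "'a set \<Rightarrow> bool" where
  "atom A \<longleftrightarrow> sfrag A \<and> 2 * card A + 1 = k"

lemma sfragI: "frag X \<Longrightarrow> (x, y) \<in> S \<Longrightarrow> x \<in> nb X \<Longrightarrow> y \<in> nb X \<Longrightarrow> sfrag X"
  by (auto simp: sfrag_def)

lemma sfrag_frag: "sfrag X \<Longrightarrow> frag X"
  by (simp add: sfrag_def)

lemma frag_V: "frag X \<Longrightarrow> X \<subseteq> V" and frag_ne: "frag X \<Longrightarrow> X \<noteq> {}"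
  and frag_nb: "frag X \<Longrightarrow> card (nb X) = k" and frag_fin: "frag X \<Longrightarrow> finite X"
  using finite_sub by (auto simp: frag_def)

lemma sfrag_opp: "sfrag X \<Longrightarrow> sfrag (opp X)"
  using frag_opp by (auto simp: sfrag_def)

lemma sfrag_big: "sfrag X \<Longrightarrow> k \<le> 2 * card X + 1"
  using big_S by (auto simp: sfrag_def)

lemma no_edge_side: "frag X \<Longrightarrow> x \<in> X \<Longrightarrow> v \<in> opp X \<Longrightarrow> (x, v) \<notin> E \<and> (v, x) \<notin> E"
  using no_edge_opp E_sym by blast

text \<open>If \<open>B\<close> or \<open>opp B\<close> cut a fragment with full corner out of
  \<open>A\<close>, then \<open>x\<close> and \<open>y\<close> would lie in its neighbourhood, and
  it would be an \<open>sfrag\<close> properly inside \<open>A\<close>, missing \<open>x\<close>.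
  Hence \<open>crossing_end\<close> applies, with \<open>y\<close> in both neighbourhoods.\<close>

lemma end_separator:
  assumes A: "sfrag A" and least: "\<And>C. sfrag C \<Longrightarrow> C \<subset> A \<Longrightarrow> False"
    and xy: "(x, y) \<in> S" "x \<in> A" "y \<notin> A"
    and B: "frag B" "x \<in> nb B" "y \<in> nb B"
  shows "atom A" "A \<subseteq> nb B" "nb A \<inter> nb B = {y}"
    "2 * card (nb A \<inter> B) + 1 = k" "2 * card (nb A \<inter> opp B) + 1 = k"
proof -
  have sB: "sfrag B"
    using sfragI B xy by blast
  have y: "y \<in> nb A"
    using xy S_subset Q_subset nbI by blast
  have no: "\<not> (frag (A \<inter> C) \<and> nb (A \<inter> C) = corner A C)" if "C = B \<or> C = opp B" for C
  proof
    assume h: "frag (A \<inter> C) \<and> nb (A \<inter> C) = corner A C"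
    have "nb C = nb B" "x \<notin> C"
      using that frag_opp(2)[OF B(1)] B(2) nb_opp_disjoint[of B] nb_disjoint[of B] by auto
    then have "x \<in> corner A C" "y \<in> corner A C"
      using xy B y by (auto simp: corner_def)
    then have "sfrag (A \<inter> C)"
      using h sfragI xy(1) by auto
    then show False
      using least[of "A \<inter> C"] xy(2) \<open>x \<notin> C\<close> by blast
  qed
  have ne: "nb A \<inter> nb B \<noteq> {}"
    using y B by auto
  have no': "\<not> (frag (A \<inter> B) \<and> nb (A \<inter> B) = corner A B)"
    "\<not> (frag (A \<inter> opp B) \<and> nb (A \<inter> opp B) = corner A (opp B))"
    by (rule no, simp)+
  note c = crossing_end[OF sfrag_frag[OF A] B(1) no' sfrag_big[OF A] sfrag_big[OF sfrag_opp[OF A]]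
      sfrag_big[OF sB] sfrag_big[OF sfrag_opp[OF sB]] ne]
  show "atom A"
    unfolding atom_def using A c(1) by blast
  show "A \<subseteq> nb B" "2 * card (nb A \<inter> B) + 1 = k" "2 * card (nb A \<inter> opp B) + 1 = k"
    by (rule c)+
  obtain z where "nb A \<inter> nb B = {z}"
    by (rule card_1_singletonE[OF c(3)])
  moreover have "y \<in> nb A \<inter> nb B"
    using y B(3) by blast
  ultimately show "nb A \<inter> nb B = {y}"
    by simp
qed

lemma atom_frag: "atom A \<Longrightarrow> frag A"
  by (simp add: atom_def sfrag_frag)

lemma atom_end:
  assumes "atom A" "sfrag C" "C \<subset> A"
  shows False
proof -
  have "card C < card A"
    using psubset_card_mono[OF frag_fin[OF atom_frag[OF assms(1)]] assms(3)] .
  moreover have "2 * card A + 1 = k"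
    using assms(1) by (simp add: atom_def)
  ultimately show False
    using sfrag_big[OF assms(2)] by linarith
qed

lemma atom_sep:
  assumes "atom A" "(x, y) \<in> S" "x \<in> A" "y \<notin> A" "frag B" "x \<in> nb B" "y \<in> nb B"
  shows "A \<subseteq> nb B" "nb A \<inter> nb B = {y}"
    "2 * card (nb A \<inter> B) + 1 = k" "2 * card (nb A \<inter> opp B) + 1 = k"
proof -
  have "sfrag A"
    using assms(1) by (simp add: atom_def)
  note c = end_separator[OF this _ assms(2-)]
  show "A \<subseteq> nb B" "nb A \<inter> nb B = {y}"
    "2 * card (nb A \<inter> B) + 1 = k" "2 * card (nb A \<inter> opp B) + 1 = k"
    by (rule c, erule (1) atom_end[OF assms(1)])+
qed

text \<open>By \<open>atom_sep\<close> each of \<open>B1\<close> and \<open>B2\<close> halves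
  \<open>nb A\<close> minus its own exit. One of two opposite pairs of corners can be uncrossed, and
  the resulting fragment meets or borders \<open>nb A\<close> in a way that contradicts
  \<open>atom_sep\<close> again.\<close>

lemma unique_exit_aux:
  assumes A: "atom A" and 1: "(x1, y1) \<in> S" "x1 \<in> A" "y1 \<notin> A" and 2: "(x2, y2) \<in> S" "x2 \<in> A" "y2 \<notin> A"
    and B1: "frag B1" "x1 \<in> nb B1" "y1 \<in> nb B1" and B2: "frag B2" "x2 \<in> nb B2" "y2 \<in> nb B2"
    and y: "y2 \<in> B1" "y1 \<in> B2"
  shows False
proof -
  note s1 = atom_sep[OF A 1 B1] and s2 = atom_sep[OF A 2 B2]
  note o1 = frag_opp[OF B1(1)] and o2 = frag_opp[OF B2(1)]
  note BV = frag_V[OF B1(1)] frag_V[OF B2(1)]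
  let ?T = "nb A"
  have yT: "y1 \<in> ?T" "y2 \<in> ?T"
    using s1 s2 by auto
  have T_sub: "?T \<inter> X \<subseteq> V" for X
    using nb_subset[of A] by (rule le_infI1)
  have c: "card (?T \<inter> B1) = card (?T \<inter> B1 \<inter> B2) + card (?T \<inter> B1 \<inter> nb B2) + card (?T \<inter> B1 \<inter> opp B2)"
    "card (?T \<inter> opp B1) = card (?T \<inter> opp B1 \<inter> B2) + card (?T \<inter> opp B1 \<inter> nb B2) + card (?T \<inter> opp B1 \<inter> opp B2)"
    "card (?T \<inter> B2) = card (?T \<inter> B2 \<inter> B1) + card (?T \<inter> B2 \<inter> nb B1) + card (?T \<inter> B2 \<inter> opp B1)"
    "card (?T \<inter> opp B2) = card (?T \<inter> opp B2 \<inter> B1) + card (?T \<inter> opp B2 \<inter> nb B1) + card (?T \<inter> opp B2 \<inter> opp B1)"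
    by (rule card_split[OF BV(2) T_sub] card_split[OF BV(1) T_sub])+
  have e: "?T \<inter> B1 \<inter> nb B2 = {y2}" "?T \<inter> opp B1 \<inter> nb B2 = {}" "?T \<inter> B2 \<inter> nb B1 = {y1}"
    "?T \<inter> opp B2 \<inter> nb B1 = {}"
  proof -
    have i: "X \<inter> Y \<inter> Z = Y \<inter> (X \<inter> Z)" for X Y Z :: "'a set"
      by auto
    have n: "y2 \<notin> opp B1" "y1 \<notin> opp B2"
      using y opp_disjoint[of B1] opp_disjoint[of B2] by auto
    show "?T \<inter> B1 \<inter> nb B2 = {y2}" "?T \<inter> opp B1 \<inter> nb B2 = {}" "?T \<inter> B2 \<inter> nb B1 = {y1}"
      "?T \<inter> opp B2 \<inter> nb B1 = {}"
      unfolding i[of ?T _ "nb B1"] i[of ?T _ "nb B2"] s1(2) s2(2) using y n by simp_all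
  qed
  have comm: "?T \<inter> B2 \<inter> B1 = ?T \<inter> B1 \<inter> B2" "?T \<inter> B2 \<inter> opp B1 = ?T \<inter> opp B1 \<inter> B2"
    "?T \<inter> opp B2 \<inter> B1 = ?T \<inter> B1 \<inter> opp B2" "?T \<inter> opp B2 \<inter> opp B1 = ?T \<inter> opp B1 \<inter> opp B2"
    by auto
  let ?p = "card (?T \<inter> B1 \<inter> B2)" and ?q = "card (?T \<inter> B1 \<inter> opp B2)"
    and ?u = "card (?T \<inter> opp B1 \<inter> B2)" and ?v = "card (?T \<inter> opp B1 \<inter> opp B2)"
  \<comment> \<open>The summands \<open>1\<close> stand for \<open>y2\<close> in \<open>B1\<close>
    and \<open>y1\<close> in \<open>B2\<close>; the other two halves contain neither exit.\<close>
  have eqs: "2 * (?p + 1 + ?q) + 1 = k" "2 * (?u + ?v) + 1 = k" "2 * (?p + 1 + ?u) + 1 = k" "2 * (?q + ?v) + 1 = k"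
    using c[unfolded comm e] s1(3,4) s2(3,4) by simp_all
  show False
  proof (cases "?q = 0")
    case False
    then have q: "?T \<inter> B1 \<inter> opp B2 \<noteq> {}"
      by auto
    have qu: "q = u" if "2 * (p + 1 + q) + 1 = k" "2 * (p + 1 + u) + 1 = k" for p q u
      using that by presburger
    have "0 < ?u"
      using False qu[OF eqs(1,3)] by (metis neq0_conv)
    then have u: "?T \<inter> opp B1 \<inter> B2 \<noteq> {}"
      by auto
    have f: "frag (B1 \<inter> opp B2)" "nb (B1 \<inter> opp B2) = corner B1 (opp B2)"
      using uncross[OF B1(1) o2(1)] q u o2(3) by auto
    have "x2 \<in> nb (B1 \<inter> opp B2)" "y2 \<in> nb (B1 \<inter> opp B2)"
      unfolding f(2) corner_def o2(2) using subsetD[OF s1(1) 2(2)] y(1) B2(2,3) by simp_all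
    \<comment> \<open>This fragment should contain half of \<open>nb A\<close> minus
      \<open>y2\<close>, but it has only \<open>?q\<close> elements there, fewer than
      \<open>?p + 1 + ?q\<close>.\<close>
    then have "2 * card (?T \<inter> (B1 \<inter> opp B2)) + 1 = k"
      by (rule atom_sep(3)[OF A 2 f(1)])
    then show False
      using eqs(1) by (simp add: Int_assoc)
  next
    case True
    \<comment> \<open>Here \<open>k > 3\<close> is needed: for \<open>k = 3\<close> the cell
      \<open>?p\<close> could be empty.\<close>
    have pv: "0 < p \<and> 0 < v" if "q = 0" "2 * (p + 1 + q) + 1 = k" "2 * (q + v) + 1 = k" for p q v
      using that k_gt by presburger
    have "0 < ?p" "0 < ?v"
      using pv[OF True eqs(1,4)] by blast+
    then have "?T \<inter> B1 \<inter> B2 \<noteq> {}" "?T \<inter> opp B1 \<inter> opp B2 \<noteq> {}"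
      by auto
    then have f: "frag (B1 \<inter> B2)" "nb (B1 \<inter> B2) = corner B1 B2"
      using uncross[OF B1(1) B2(1)] by auto
    have "x1 \<in> nb (B1 \<inter> B2)" "y1 \<in> nb (B1 \<inter> B2)" "y2 \<in> nb (B1 \<inter> B2)"
      unfolding f(2) corner_def using subsetD[OF s2(1) 1(2)] y B1(2,3) B2(3) by simp_all
    then have "y2 = y1"
      using atom_sep(2)[OF A 1 f(1)] yT(2) by blast
    moreover have "y2 \<notin> nb B1"
      using y(1) nb_disjoint[of B1] by blast
    ultimately show False
      using B1(3) by simp
  qed
qed

lemma unique_exit:
  assumes A: "atom A" and 1: "(x1, y1) \<in> S" "x1 \<in> A" "y1 \<notin> A" and 2: "(x2, y2) \<in> S" "x2 \<in> A" "y2 \<notin> A"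
  shows "y1 = y2"
proof (rule ccontr)
  assume ne: "y1 \<noteq> y2"
  obtain B1 where B1: "frag B1" "x1 \<in> nb B1" "y1 \<in> nb B1"
    using S_sep[OF 1(1)] by blast
  obtain B2 where B2: "frag B2" "x2 \<in> nb B2" "y2 \<in> nb B2"
    using S_sep[OF 2(1)] by blast
  note o1 = frag_opp[OF B1(1)] and o2 = frag_opp[OF B2(1)]
  note s1 = atom_sep[OF A 1 B1] and s2 = atom_sep[OF A 2 B2]
  have "y2 \<notin> nb B1" "y1 \<notin> nb B2"
    using s1(2) s2(2) ne by auto
  moreover have "y1 \<in> V" "y2 \<in> V"
    using nb_subset B1(3) B2(3) by auto
  ultimately have "y2 \<in> B1 \<or> y2 \<in> opp B1" "y1 \<in> B2 \<or> y1 \<in> opp B2"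
    using split_V[OF frag_V[OF B1(1)], of y2] split_V[OF frag_V[OF B2(1)], of y1] by simp_all
  \<comment> \<open>Replacing a separating fragment by its opposite keeps its neighbourhood, so the
    exits may be assumed to lie as in \<open>unique_exit_aux\<close>.\<close>
  then obtain C1 C2 where "C1 = B1 \<or> C1 = opp B1" "y2 \<in> C1" "C2 = B2 \<or> C2 = opp B2" "y1 \<in> C2"
    by metis
  then show False
    using unique_exit_aux[OF A 1 2, of C1 C2] B1 B2 o1(1,2) o2(1,2) by (elim disjE) simp_all
qed

text \<open>Since \<open>A\<close> avoids \<open>U\<close>, all tree arcs leaving \<open>A\<close>
  belong to \<open>S\<close>, which is what makes the single exit available.\<close>

definition free :: "'a set \<Rightarrow> 'a \<Rightarrow> bool" where
  "free A y \<longleftrightarrow> atom A \<and> A \<inter> U = {} \<and> only_exit A y \<and> (\<exists>x\<in>A. (x, y) \<in> S)"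

lemma free_atom: "free A y \<Longrightarrow> atom A" and free_exit: "free A y \<Longrightarrow> only_exit A y"
  by (auto simp: free_def)

lemma opp_ne: "frag X \<Longrightarrow> opp X \<noteq> {}"
  by (simp add: frag_def)

lemma frag_neq_V: "frag X \<Longrightarrow> X \<noteq> V"
  using opp_ne opp_subset opp_disjoint by blast

text \<open>A smallest \<open>sfrag\<close> inside \<open>X\<close> is inclusion-minimal among all
  of them, so \<open>end_separator\<close> makes it an atom and \<open>unique_exit\<close> gives its
  exit.\<close>

lemma free_atom_exists:
  assumes X: "sfrag X" "X \<inter> U = {}"
  obtains A y where "free A y" "A \<subseteq> X"
proof -
  obtain A where A: "sfrag A" "A \<subseteq> X" and min: "\<And>C. sfrag C \<Longrightarrow> C \<subseteq> X \<Longrightarrow> card A \<le> card C"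
    using ex_has_least_nat[of "\<lambda>C. sfrag C \<and> C \<subseteq> X" X card] X by auto
  have least: False if "sfrag C" "C \<subset> A" for C
    using min[OF that(1)] that A psubset_card_mono[OF frag_fin[OF sfrag_frag[OF A(1)]] that(2)] by auto
  have AU: "A \<inter> U = {}"
    using A X by auto
  have inS: "(u, v) \<in> S" if "u \<in> A" "(u, v) \<in> Q" for u v
    using not_S[of u v] that AU by auto
  obtain x y where xy: "x \<in> A" "y \<notin> A" "(x, y) \<in> Q"
    using exit_exists[of A] A sfrag_frag frag_V frag_ne frag_neq_V by metis
  have "(x, y) \<in> S"
    using inS xy by blast
  then obtain B where B: "frag B" "x \<in> nb B" "y \<in> nb B"
    using S_sep by blast
  have at: "atom A"
    using end_separator(1)[OF A(1) least \<open>(x, y) \<in> S\<close> xy(1,2) B] .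
  have "only_exit A y"
    unfolding only_exit_def
  proof (intro conjI allI impI)
    fix u v assume "u \<in> A" "v \<notin> A" "(u, v) \<in> Q"
    then show "v = y"
      using unique_exit[OF at] inS xy by blast
  qed (use at atom_frag frag_V xy Q_V in auto)
  then have "free A y"
    using at AU xy inS by (auto simp: free_def)
  then show ?thesis
    using that A by blast
qed

lemma free_separator:
  assumes "free A y"
  obtains B where "frag B" "insert y A \<subseteq> nb B"
    "nb A \<inter> nb B = {y}" "2 * card (nb A \<inter> B) + 1 = k" "2 * card (nb A \<inter> opp B) + 1 = k"
proof -
  obtain x where x: "x \<in> A" "(x, y) \<in> S" "y \<notin> A"
    using assms by (auto simp: free_def only_exit_def)
  obtain B where B: "frag B" "x \<in> nb B" "y \<in> nb B"
    using S_sep x by blast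
  show ?thesis
    using that[OF B(1)] atom_sep[OF free_atom[OF assms] x(2,1,3) B] B by simp
qed

lemma free_sep:
  assumes "free A y" "frag B" "insert y A \<subseteq> nb B"
  shows "nb A \<inter> nb B = {y}" "2 * card (nb A \<inter> B) + 1 = k" "2 * card (nb A \<inter> opp B) + 1 = k"
proof -
  obtain x where x: "x \<in> A" "(x, y) \<in> S" "y \<notin> A"
    using assms by (auto simp: free_def only_exit_def)
  then have B: "x \<in> nb B" "y \<in> nb B"
    using assms by auto
  show "nb A \<inter> nb B = {y}" "2 * card (nb A \<inter> B) + 1 = k" "2 * card (nb A \<inter> opp B) + 1 = k"
    using atom_sep[OF free_atom[OF assms(1)] x(2,1,3) assms(2) B] by simp_all
qed

lemma free_sfrag: "free A y \<Longrightarrow> frag B \<Longrightarrow> insert y A \<subseteq> nb B \<Longrightarrow> sfrag B"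
  using sfragI by (auto simp: free_def)

text \<open>If \<open>A\<close> met both sides, the part in \<open>B\<close> would have all its
  neighbours in \<open>nb A\<close>, hence the same neighbourhood as \<open>A\<close>, and would be
  a smaller \<open>sfrag\<close>.\<close>

lemma atom_side:
  assumes A: "atom A" and B: "frag B" and disj: "A \<inter> nb B = {}"
  shows "A \<subseteq> B \<or> A \<subseteq> opp B"
proof (rule ccontr)
  assume "\<not> ?thesis"
  then have ne: "A \<inter> B \<noteq> {}" "A \<inter> B \<subset> A"
    using disj split_V[OF frag_V[OF B]] frag_V[OF atom_frag[OF A]] opp_disjoint by blast+
  have AV: "A \<subseteq> V"
    using frag_V atom_frag A by blast
  have sub: "nb (A \<inter> B) \<subseteq> nb A"
  proof
    fix v assume "v \<in> nb (A \<inter> B)"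
    then obtain u where u: "u \<in> A" "u \<in> B" "(u, v) \<in> E" "v \<in> V" "\<not> (v \<in> A \<and> v \<in> B)"
      by (auto simp: nb_def)
    then have "v \<notin> opp B"
      using no_edge_opp by blast
    then have "v \<notin> A"
      using u disj split_V[OF frag_V[OF B]] by blast
    then show "v \<in> nb A"
      using u nbI by blast
  qed
  have "opp A \<subseteq> opp (A \<inter> B)"
    using sub by (auto simp: opp_def)
  then have o: "opp (A \<inter> B) \<noteq> {}"
    using opp_ne[OF atom_frag[OF A]] by blast
  have "k \<le> card (nb (A \<inter> B))"
    using k_le ne o AV by blast
  then have eq: "nb (A \<inter> B) = nb A"
    using card_seteq[OF finite_sub[OF nb_subset] sub] frag_nb[OF atom_frag[OF A]] by simp
  then have "sfrag (A \<inter> B)"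
    using A o ne AV by (auto simp: atom_def sfrag_def frag_def)
  then show False
    using atom_end[OF A] ne by blast
qed

lemma free_side:
  assumes A: "free A y" and B: "frag B" and disj: "insert y A \<inter> nb B = {}"
  shows "insert y A \<subseteq> B \<or> insert y A \<subseteq> opp B"
proof -
  obtain x where x: "x \<in> A" "(x, y) \<in> E" "y \<in> V"
    using A S_subset Q_subset E_subset by (auto simp: free_def)
  then have "y \<in> B \<or> y \<in> opp B"
    using disj split_V[OF frag_V[OF B]] by blast
  moreover have "A \<subseteq> B \<or> A \<subseteq> opp B"
    using atom_side[OF free_atom[OF A] B] disj by blast
  ultimately show ?thesis
    using x no_edge_side[OF B] by blast
qed

lemma card_free: "free A y \<Longrightarrow> 2 * card (insert y A) = k + 1"
proof -
  assume A: "free A y"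
  then have "y \<notin> A" "finite A" "2 * card A + 1 = k"
    using frag_fin[OF atom_frag[OF free_atom[OF A]]] by (auto simp: free_def only_exit_def atom_def)
  then show ?thesis
    by simp
qed

lemma root_path_butlast:
  assumes "root_path p y"
  obtains p1 where "p = p1 @ [y]" "walk Q p1" "y \<notin> set p1" "p1 = [] \<or> r \<in> set p1"
proof -
  have p: "p \<noteq> []" "hd p = r" "last p = y" "distinct p" "walk Q p"
    using assms by (auto simp: root_path_def)
  have eq: "p = butlast p @ [y]"
    using append_butlast_last_id[OF p(1)] p(3) by simp
  have d: "distinct (butlast p @ [y])" "walk Q (butlast p @ [y])" "hd (butlast p @ [y]) = r"
    using p eq by simp_all
  have "butlast p = [] \<or> r \<in> set (butlast p)"
    using d(3) hd_in_set[of "butlast p"] by (cases "butlast p = []") auto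
  then show ?thesis
    using that[OF eq] d(1,2) by (simp add: walk_append)
qed

text \<open>One of the two sets misses \<open>r\<close>, so its neighbourhood lies on the root path
  to \<open>y\<close>. Before \<open>y\<close> this path stays inside the other set, which together
  with \<open>y\<close> has fewer than \<open>k\<close> elements.\<close>

lemma same_exit:
  assumes A: "frag A" "2 * card A + 1 = k" "only_exit A y" and B: "frag B" "2 * card B + 1 = k" "only_exit B y"
    and adj: "A \<subseteq> nb B"
  shows False
proof -
  have disj: "A \<inter> B = {}"
    using adj nb_disjoint by blast
  have y: "y \<in> V" "y \<notin> A" "y \<notin> B"
    using A B by (auto simp: only_exit_def)
  obtain p where p: "root_path p y"
    using root_path_exists y by blast
  obtain p1 where p1: "p = p1 @ [y]" "walk Q p1" "y \<notin> set p1" "p1 = [] \<or> r \<in> set p1"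
    by (rule root_path_butlast[OF p])
  have small: False if "frag X" "nb X \<subseteq> insert y Z" "frag Z" "2 * card Z + 1 = k" for X Z
  proof -
    have "card (nb X) \<le> card (insert y Z)"
      using that finite_sub frag_V by (intro card_mono) auto
    also have "\<dots> \<le> card Z + 1"
      by (simp add: card_insert_le_m1 card_insert_if frag_fin[OF that(3)])
    finally show False
      using that(4) k_gt frag_nb[OF that(1)] by linarith
  qed
  show False
  proof (cases "r \<in> B")
    case False
    have nbB: "nb B \<subseteq> set p"
      using neighbours_on_root_path[OF B(3) False p] by (auto simp: nb_def)
    obtain x where "x \<in> A"
      using frag_ne[OF A(1)] by blast
    then have "x \<in> set p1"
      using nbB adj p1(1) y by auto
    then have "set p1 \<subseteq> A"
      using only_exit_walk[OF A(3) p1(2,3)] \<open>x \<in> A\<close> by blast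
    then show False
      using small[OF B(1) _ A(1,2)] nbB p1(1) by auto
  next
    case True
    then have "r \<notin> A" "p1 \<noteq> []"
      using disj p p1(1) y by (auto simp: root_path_def)
    then have nbA: "nb A \<subseteq> set p"
      using neighbours_on_root_path[OF A(3) _ p] by (auto simp: nb_def)
    have "set p1 \<subseteq> B"
      using only_exit_walk[OF B(3) p1(2,3) _ True] p1(4) \<open>p1 \<noteq> []\<close> by blast
    then show False
      using small[OF A(1) _ B(1,2)] nbA p1(1) by auto
  qed
qed

end

section \<open>The extremal fragment\<close>

text \<open>The variant of \<open>crossing_end_arith\<close> in which \<open>t\<close> may be 0 but
  \<open>nA\<close> is as small as possible. If just one corner inside \<open>A\<close> is nonempty,
  then \<open>a1\<close> exceeds \<open>b1\<close> or \<open>b2\<close>, a cell with at least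
  \<open>nA\<close> elements, although \<open>a1 \<le> nA\<close>.\<close>

lemma crossing_atom_arith:
  fixes k a1 t a2 b1 b2 nA n11 n12 nA' n21 n22 nB nB' :: nat
  assumes eqs: "a1 + t + a2 = k" "b1 + t + b2 = k"
    "nA = n11 + a1 + n12" "nA' = n21 + a2 + n22" "nB = n11 + b1 + n21" "nB' = n12 + b2 + n22"
    and d: "n11 = 0 \<or> k < a1 + t + b1" "n12 = 0 \<or> k < a1 + t + b2"
    "n21 = 0 \<or> k \<le> a2 + t + b1" "n22 = 0 \<or> k \<le> a2 + t + b2"
    and big: "2 * nA + 1 = k" "k \<le> 2 * nA' + 1" "k \<le> 2 * nB + 1" "k \<le> 2 * nB' + 1"
  shows "n11 = 0 \<and> n12 = 0"
proof -
  have n22: "n22 = 0" if h: "k < a1 + t + b1"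
    using d(4) by (rule disjE) (use h eqs in linarith)+
  have n21: "n21 = 0" if h: "k < a1 + t + b2"
    using d(3) by (rule disjE) (use h eqs in linarith)+
  have 1: "n11 = 0 \<or> n12 = 0"
  proof (rule ccontr)
    assume "\<not> ?thesis"
    then have h: "k < a1 + t + b1" "k < a1 + t + b2"
      using d by auto
    show False
      using h n22[OF h(1)] n21[OF h(2)] eqs big by linarith
  qed
  have 2: "n11 = 0"
  proof (rule ccontr)
    assume "n11 \<noteq> 0"
    then have h: "k < a1 + t + b1" "n12 = 0"
      using d 1 by auto
    show False
      using h n22[OF h(1)] eqs big by linarith
  qed
  have 3: "n12 = 0"
  proof (rule ccontr)
    assume "n12 \<noteq> 0"
    then have h: "k < a1 + t + b2"
      using d by auto
    show False
      using h n21[OF h(1)] 2 eqs big by linarith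
  qed
  show ?thesis
    using 2 3 by blast
qed

context covered_dfs_tree
begin

lemma avoiding_side:
  assumes "frag X"
  obtains C where "C = X \<or> C = opp X" "C \<inter> U = {}"
proof (cases "X \<inter> U = {}")
  case False
  then obtain u w where U: "U = {u, w}" "(u, w) \<in> E"
    using U_edge by blast
  have "opp X \<inter> U = {}"
    using False U no_edge_side[OF assms] opp_disjoint[of X] by auto
  then show ?thesis
    using that by blast
qed (use that in blast)

text \<open>Apart from \<open>y\<close> and \<open>y2\<close> the tree offers no passage between
  \<open>B\<close> and the rest. Both \<open>A\<close> and \<open>A2\<close> have neighbours inside
  and outside \<open>B\<close>, and these would have to fit on a single root path.\<close>

lemma no_straddling_separator:
  assumes B: "frag B" "nb B = insert y (A \<union> D)" "A \<inter> D = {}" "y \<notin> D"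
    and A: "only_exit A y" and A2: "only_exit A2 y2" "A2 \<subseteq> B" "y2 \<in> B"
    and D: "D \<subseteq> nb A2" "D \<noteq> {}" "\<And>d v. (d, v) \<in> Q \<Longrightarrow> d \<in> D \<Longrightarrow> v \<in> B \<Longrightarrow> v = y2"
    and c: "c \<in> nb A" "c \<in> B" "c \<notin> A2" "c \<noteq> y2" and c': "c' \<in> nb A" "c' \<in> opp B"
    and h: "h \<in> nb A2" "h \<in> B" "h \<noteq> y2"
  shows False
proof -
  have closed1: "v \<in> B" if "(u, v) \<in> Q" "u \<in> B" "u \<noteq> y2" "v \<noteq> y" for u v
  proof (rule ccontr)
    assume v: "v \<notin> B"
    have "(u, v) \<in> E"
      using that Q_subset by blast
    then have "v \<in> nb B"
      using nbI[of u v B] that v by blast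
    then have "v \<in> A \<or> v \<in> D"
      using B(2) that(4) by blast
    then show False
    proof
      assume "v \<in> A"
      moreover have "u \<notin> A"
        using that(2) B(2) nb_disjoint[of B] by blast
      ultimately have "u = y"
        using only_exitD[OF A] Q_sym that(1) by blast
      then show False
        using that(2) B(2) nb_disjoint[of B] by blast
    next
      assume "v \<in> D"
      then show False
        using D(3) Q_sym that by blast
    qed
  qed
  have piece: "set q \<subseteq> B" if q: "walk Q q" "y \<notin> set q" "y2 \<notin> set q" "z \<in> set q" "z \<in> B" for q z
    by (rule walk_const[OF q(1) _ q(4,5)]) (use closed1 Q_sym q(2,3) in metis)
  have y: "y \<notin> A" "y \<notin> B" "y2 \<notin> A2" "y \<in> V" "y2 \<in> V"
    using A A2 B(2) nb_disjoint[of B] by (auto simp: only_exit_def)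
  have DB: "D \<inter> B = {}" "A \<inter> B = {}"
    using B(2) nb_disjoint[of B] by auto
  have c'B: "c' \<notin> B" "c' \<notin> nb B"
    using c' opp_disjoint[of B] nb_opp_disjoint[of B] by auto
  have ne: "c \<noteq> y" "c' \<noteq> y"
    using c(2) y c'B B(2) by auto
  show False
  proof (cases "r \<in> A2")
    case False
    obtain p where p: "root_path p y2"
      using root_path_exists y by blast
    have nb2: "nb A2 \<subseteq> set p"
      using neighbours_on_root_path[OF A2(1) False p] by (auto simp: nb_def)
    obtain p0 where p0: "p = p0 @ [y2]" "walk Q p0" "y2 \<notin> set p0" "p0 = [] \<or> r \<in> set p0"
      by (rule root_path_butlast[OF p])
    obtain d where d: "d \<in> D"
      using D(2) by blast
    have Dp: "D \<subseteq> set p0" "h \<in> set p0"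
      using D(1) nb2 p0(1) A2(3) DB h by auto
    \<comment> \<open>The path to \<open>y2\<close> contains \<open>h\<close> inside
      \<open>B\<close> and \<open>D\<close> outside \<open>B\<close>, so it must change sides at
      \<open>y\<close>.\<close>
    have "y \<in> set p0"
    proof (rule ccontr)
      assume "y \<notin> set p0"
      then have "set p0 \<subseteq> B"
        using piece[OF p0(2) _ p0(3) Dp(2) h(2)] by blast
      then show False
        using Dp d DB by blast
    qed
    then obtain p1 p2 where s: "p0 = p1 @ y # p2"
      by (meson split_list)
    have dist: "distinct p" "hd p = r"
      using p by (auto simp: root_path_def)
    then have n: "y \<notin> set p1" "y \<notin> set p2" "y2 \<notin> set p1" "y2 \<notin> set p2"
      using p0(1,3) s by auto
    have "walk Q ((p1 @ [y]) @ p2)"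
      using p0(2) s by simp
    then have w: "walk Q (p1 @ [y])" "walk Q p2"
      by (simp_all only: walk_append)
    then have w1: "walk Q p1"
      by (simp only: walk_append)
    have rp: "root_path (p1 @ [y]) y"
      unfolding root_path_def using w(1) dist p0(1) s n by (cases p1) auto
    have nbA: "nb A \<subseteq> insert y (set p1)" if "r \<notin> A"
      using neighbours_on_root_path[OF A that rp] by (auto simp: nb_def)
    have r1: "p1 = [] \<or> r \<in> set p1"
      using dist p0(1) s by (cases p1) auto
    have "h \<noteq> y" "d \<noteq> y"
      using h y d B(4) by auto
    then have "h \<in> set p1 \<or> h \<in> set p2"
      using Dp(2) s by auto
    then show False
    proof
      \<comment> \<open>The path before \<open>y\<close> stays in \<open>B\<close>, but it should
        contain the neighbour \<open>c'\<close> of \<open>A\<close> beyond \<open>B\<close>.\<close>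
      assume h1: "h \<in> set p1"
      then have "set p1 \<subseteq> B"
        using piece[OF w1 n(1,3) _ h(2)] by blast
      moreover have "r \<in> set p1"
        using r1 h1 by (metis empty_iff empty_set)
      ultimately show False
        using nbA DB c' c'B ne by blast
    next
      \<comment> \<open>Now \<open>D\<close> lies before \<open>y\<close>, so that part of the path
        stays outside \<open>B\<close>, but it should contain the neighbour \<open>c\<close> of
        \<open>A\<close> in \<open>B\<close>.\<close>
      assume "h \<in> set p2"
      then have "set p2 \<subseteq> B"
        using piece[OF w(2) n(2,4) _ h(2)] by blast
      then have d1: "d \<in> set p1"
        using Dp(1) d s DB B(4) by auto
      have "c \<notin> set p1"
        using piece[OF w1 n(1,3) _ c(2)] d1 d DB by blast
      moreover have "r \<notin> A"
      proof
        assume "r \<in> A"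
        moreover have "r \<in> set p1"
          using r1 d1 by (metis empty_iff empty_set)
        ultimately have "set p1 \<subseteq> A"
          using only_exit_walk[OF A w1 n(1)] by blast
        then show False
          using d1 d B(3) by blast
      qed
      ultimately show False
        using nbA c(1) ne by blast
    qed
  next
    case True
    then have "r \<notin> A"
      using A2(2) DB by blast
    obtain p where p: "root_path p y"
      using root_path_exists y by blast
    have nbA: "nb A \<subseteq> set p"
      using neighbours_on_root_path[OF A \<open>r \<notin> A\<close> p] by (auto simp: nb_def)
    obtain p1 where p1: "p = p1 @ [y]" "walk Q p1" "y \<notin> set p1" "p1 = [] \<or> r \<in> set p1"
      by (rule root_path_butlast[OF p])
    have cp: "c \<in> set p1" "c' \<in> set p1"
      using nbA c(1) c'(1) p1(1) ne by auto
    have "y2 \<in> set p1"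
      using piece[OF p1(2,3) _ cp(1) c(2)] cp(2) c'B by blast
    then obtain p3 p4 where s: "p1 = p3 @ y2 # p4"
      by (meson split_list)
    have dist: "distinct p" "hd p = r"
      using p by (auto simp: root_path_def)
    have n: "y2 \<notin> set p3" "y2 \<notin> set p4" "y \<notin> set p4"
      using dist p1(1,3) s by auto
    have "walk Q (p3 @ ([y2] @ p4))"
      using p1(2) s by simp
    then have w: "walk Q p3" "walk Q p4"
      by (simp_all only: walk_append)
    \<comment> \<open>Before \<open>y2\<close> the path stays in \<open>A2\<close>, so
      \<open>c\<close> and \<open>c'\<close> both come after \<open>y2\<close>, where nothing allows
      a change of side.\<close>
    have "set p3 \<subseteq> A2"
    proof (cases "p3 = []")
      case False
      then have "r \<in> set p3"
        using dist p1(1) s by (cases p3) auto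
      then show ?thesis
        using only_exit_walk[OF A2(1) w(1) n(1) _ True] by blast
    qed simp
    then have "c \<in> set p4" "c' \<in> set p4"
      using cp s c c'B A2(2,3) by auto
    then show False
      using piece[OF w(2) n(3,2) _ c(2)] c'B by blast
  qed
qed

text \<open>Unlike in \<open>atom_sep\<close>, no common tree edge is required:
  \<open>big_all\<close> rules out every fragment smaller than an atom.\<close>

lemma atom_in_separator:
  assumes "U \<noteq> {}" "atom A" "frag B" "A \<inter> nb B \<noteq> {}"
  shows "A \<subseteq> nb B"
proof -
  have A: "frag A" "2 * card A + 1 = k"
    using assms(2) by (auto simp: atom_def sfrag_def)
  note big = big_all[OF assms(1)]
  have no: "\<not> (frag (A \<inter> C) \<and> nb (A \<inter> C) = corner A C)" if "C = B \<or> C = opp B" for C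
  proof
    assume f: "frag (A \<inter> C) \<and> nb (A \<inter> C) = corner A C"
    have "C \<inter> nb B = {}"
      using that nb_opp_disjoint[of B] nb_disjoint[of B] by auto
    then have "A \<inter> C \<subset> A"
      using assms(4) by blast
    then have "card (A \<inter> C) < card A"
      by (rule psubset_card_mono[OF frag_fin[OF A(1)]])
    then show False
      using big[of "A \<inter> C"] f A(2) by linarith
  qed
  have no': "\<not> (frag (A \<inter> B) \<and> nb (A \<inter> B) = corner A B)"
    "\<not> (frag (A \<inter> opp B) \<and> nb (A \<inter> opp B) = corner A (opp B))"
    by (rule no, simp)+
  have "card (A \<inter> B) = 0 \<and> card (A \<inter> opp B) = 0"
    by (rule crossing_atom_arith[OF crossing_counts[OF A(1) assms(3) no'] A(2)
          big[OF frag_opp(1)[OF A(1)]] big[OF assms(3)] big[OF frag_opp(1)[OF assms(3)]]])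
  then have "A \<inter> B = {}" "A \<inter> opp B = {}"
    using frag_fin[OF A(1)] by simp_all
  then show ?thesis
    using split_V[OF frag_V[OF assms(3)]] frag_V[OF A(1)] by blast
qed

text \<open>The candidates for the extremal fragment. Avoiding \<open>U\<close> guarantees that such
  a fragment contains a free atom of its own.\<close>

definition near :: "'a set \<Rightarrow> bool" where
  "near B \<longleftrightarrow> frag B \<and> B \<inter> U = {} \<and> (\<exists>A y. free A y \<and> insert y A \<subseteq> nb B)"

lemma near_exists: "\<exists>B. near B"
proof -
  have "card U \<le> 2"
  proof (cases "U = {}")
    case False
    then obtain u w where "U = {u, w}"
      using U_edge by blast
    then show ?thesis
      by (simp add: card_insert_if)
  qed simp
  moreover have "finite U"
    using U_edge by auto
  \<comment> \<open>A vertex outside \<open>U\<close> has a tree edge, and that edge lies in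
    \<open>S\<close>.\<close>
  ultimately have "\<not> V \<subseteq> U"
    using card_V card_mono[of U V] by linarith
  then obtain v where v: "v \<in> V" "v \<notin> U"
    by blast
  have "{v} \<noteq> V"
    using card_V by auto
  then obtain w where "(v, w) \<in> Q"
    using exit_exists[of "{v}"] v(1) by blast
  then have vw: "(v, w) \<in> S"
    using not_S v(2) by blast
  then obtain X where X: "frag X" "v \<in> nb X" "w \<in> nb X"
    using S_sep by blast
  then have sX: "sfrag X"
    using sfragI vw by blast
  obtain C where C: "C = X \<or> C = opp X" "C \<inter> U = {}"
    by (rule avoiding_side[OF X(1)])
  then have "sfrag C"
    using sX sfrag_opp by blast
  then obtain A y where A: "free A y"
    using free_atom_exists C(2) by metis
  obtain B where B: "frag B" "insert y A \<subseteq> nb B"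
    by (rule free_separator[OF A])
  obtain B' where B': "B' = B \<or> B' = opp B" "B' \<inter> U = {}"
    by (rule avoiding_side[OF B(1)])
  then have "frag B'" "nb B' = nb B"
    using B(1) frag_opp[OF B(1)] by auto
  then show ?thesis
    unfolding near_def using A B(2) B'(2)
    by (intro exI[of _ B'] conjI exI[of _ A] exI[of _ y]) simp_all
qed

text \<open>Both \<open>big_all\<close> and \<open>k > 3\<close> are essential: this fails for the prism, where \<open>k = 3\<close>, and for
  its blow-ups by cliques, which have fragments of size 1.
  If \<open>A\<close> and \<open>A2\<close> are adjacent, then counting forces \<open>B = insert y2 A2\<close>, and \<open>y2\<close> has only \<open>k\<close>
  neighbours, so that \<open>{y2}\<close> is a fragment.\<close>

lemma atoms_apart:
  assumes U: "U \<noteq> {}" and B: "frag B" "nb B = insert y (A \<union> D)" and A: "free A y"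
    and A2: "atom A2" "A2 \<subseteq> B" "y2 \<in> B" "y2 \<in> nb A2" and D: "2 * card D + 1 = k" "finite D"
    "D \<subseteq> nb A2" "nb D \<inter> B = insert y2 A2" "A \<inter> D = {}"
  shows "A \<inter> nb A2 = {}"
proof (rule ccontr)
  assume ne: "A \<inter> nb A2 \<noteq> {}"
  have atA: "atom A" and fA: "frag A" and fA2: "frag A2"
    using A A2(1) free_atom atom_frag by auto
  have cards: "2 * card A + 1 = k" "2 * card A2 + 1 = k" and fin: "finite A" "finite A2"
    using atA A2(1) frag_fin fA fA2 by (auto simp: atom_def)
  have 1: "A \<subseteq> nb A2"
    by (rule atom_in_separator[OF U atA fA2 ne])
  obtain a0 x where "a0 \<in> A" "x \<in> A2" "(x, a0) \<in> E"
    using ne by (auto simp: nb_def)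
  moreover have "x \<notin> A"
    using \<open>x \<in> A2\<close> 1 nb_disjoint[of A2] by blast
  ultimately have "A2 \<inter> nb A \<noteq> {}"
    using nbI[of a0 x A] E_sym by blast
  then have 2: "A2 \<subseteq> nb A"
    by (rule atom_in_separator[OF U A2(1) fA])
  have "insert y A \<subseteq> nb B"
    using B(2) by blast
  note sA = free_sep[OF A B(1) this]
  have "A2 \<subseteq> nb A \<inter> B" "card (nb A \<inter> B) = card A2" "finite (nb A \<inter> B)"
    using 2 A2(2) sA(2) cards(2) frag_fin[OF B(1)] by simp_all
  then have nbA: "nb A \<inter> B = A2"
    by (metis card_subset_eq)
  have disjB: "nb B \<inter> B = {}"
    using nb_disjoint[of B] by blast
  have y2: "y2 \<notin> A" "y2 \<notin> D" "y2 \<notin> A2" "y \<notin> A2" "y2 \<noteq> y" "y \<notin> B"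
    using A2 B(2) disjB nb_disjoint[of A2] by blast+
  \<comment> \<open>These \<open>k\<close> vertices all belong to \<open>nb A2\<close>, hence
    exhaust it.\<close>
  have cs: "card (insert y2 (A \<union> D)) = k"
    using y2 D cards fin by (simp add: card_Un_disjoint)
  have nbA2: "nb A2 = insert y2 (A \<union> D)"
    by (rule sym, rule card_subset_eq[OF finite_sub[OF nb_subset]])
      (use 1 D(3) A2(4) cs frag_nb[OF fA2] in simp_all)
  have out: "v \<in> B \<or> v \<in> A \<or> v \<in> D \<or> v = y" if "u \<in> B" "(u, v) \<in> E" for u v
    using that B(2) nbI[of u v B] by blast
  \<comment> \<open>The neighbours in \<open>B\<close> of \<open>A\<close>, \<open>A2\<close> and
    \<open>D\<close> all lie in \<open>insert y2 A2\<close>. So the remainder \<open>Z\<close> of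
    \<open>B\<close> is adjacent only to \<open>y\<close> and \<open>y2\<close>, too few for a
    nonempty set.\<close>
  define Z where "Z = B - insert y2 A2"
  have "Z = {}"
  proof (rule ccontr)
    assume Z: "Z \<noteq> {}"
    have sub: "nb Z \<subseteq> {y, y2}"
    proof
      fix v assume "v \<in> nb Z"
      then obtain u where u: "u \<in> B" "u \<noteq> y2" "u \<notin> A2" "(u, v) \<in> E" "v \<notin> Z"
        by (auto simp: nb_def Z_def)
      have "v \<notin> A2"
      proof
        assume "v \<in> A2"
        then have "u \<in> nb A2"
          using nbI[of v u A2] u E_sym by blast
        then show False
          using nbA2 u B(2) disjB by blast
      qed
      moreover have "v \<notin> A"
      proof
        assume v: "v \<in> A"
        have "u \<notin> A"
          using u(1) B(2) disjB by blast
        then have "u \<in> nb A"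
          using nbI[of v u A] v u E_sym by blast
        then show False
          using nbA u by blast
      qed
      moreover have "v \<notin> D"
      proof
        assume v: "v \<in> D"
        have "u \<notin> D"
          using u(1) B(2) disjB by blast
        then have "u \<in> nb D"
          using nbI[of v u D] v u E_sym by blast
        then show False
          using D(4) u by blast
      qed
      ultimately show "v \<in> {y, y2}"
        using out[OF u(1,4)] u(5) by (auto simp: Z_def)
    qed
    have ZV: "Z \<subseteq> V"
      using frag_V[OF B(1)] by (auto simp: Z_def)
    have "A2 \<subseteq> opp Z"
      using frag_V[OF fA2] sub y2 unfolding opp_def Z_def by blast
    then have "opp Z \<noteq> {}"
      using frag_ne[OF fA2] by blast
    then have "k \<le> card (nb Z)"
      using k_le ZV Z by blast
    moreover have "card (nb Z) \<le> card {y, y2}"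
      using sub by (intro card_mono) auto
    moreover have "card {y, y2} \<le> 2"
      by (simp add: card_insert_if)
    ultimately show False
      using k_gt by linarith
  qed
  then have B_eq: "B = insert y2 A2"
    using A2(2,3) unfolding Z_def by blast
  have sub: "nb {y2} \<subseteq> insert y (A2 \<union> D)"
  proof
    fix v assume "v \<in> nb {y2}"
    then have v: "(y2, v) \<in> E" "v \<noteq> y2"
      by (auto simp: nb_def)
    have "v \<notin> A"
    proof
      assume "v \<in> A"
      then have "y2 \<in> nb A"
        using nbI[of v y2 A] v E_sym y2 by blast
      then show False
        using nbA A2(3) y2 by blast
    qed
    then show "v \<in> insert y (A2 \<union> D)"
      using out[OF A2(3) v(1)] v(2) B_eq by blast
  qed
  have "card (nb {y2}) \<le> card (insert y (A2 \<union> D))"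
    using sub fin D(2) by (intro card_mono) auto
  also have "\<dots> \<le> 1 + (card A2 + card D)"
    using card_Un_le[of A2 D] card_insert_le_m1[of "1 + (card A2 + card D)" "A2 \<union> D" y] by simp
  finally have le: "card (nb {y2}) \<le> k"
    using cards D(1) by linarith
  have yV: "{y2} \<subseteq> V"
    using frag_V[OF B(1)] A2(3) by blast
  have "y \<noteq> a" if "a \<in> A" for a
    using A that by (auto simp: free_def only_exit_def)
  moreover have "A \<inter> A2 = {}"
    using 1 nb_disjoint[of A2] by blast
  ultimately have "A \<subseteq> opp {y2}"
    using sub frag_V[OF fA] y2 D(5) unfolding opp_def by blast
  then have o: "opp {y2} \<noteq> {}"
    using frag_ne[OF fA] by blast
  then have "frag {y2}"
    unfolding frag_def using k_le[OF yV _ o] le yV by simp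
  then have "k \<le> 3"
    using big_all[OF U, of "{y2}"] by simp
  then show False
    using k_gt by simp
qed

lemma covered_dfs_tree_false: False
proof -
  obtain B where B: "near B" and B_min: "\<And>C. near C \<Longrightarrow> card B \<le> card C"
    using near_exists ex_has_least_nat[of near _ card] by blast
  obtain A y where A: "free A y" "insert y A \<subseteq> nb B" and fB: "frag B" "B \<inter> U = {}"
    using B by (auto simp: near_def)
  have sB: "sfrag B"
    by (rule free_sfrag[OF A(1) fB(1) A(2)])
  obtain A2 y2 where A2: "free A2 y2" "A2 \<subseteq> B"
    by (rule free_atom_exists[OF sB fB(2)])
  obtain B2 where B2: "frag B2" "insert y2 A2 \<subseteq> nb B2"
    by (rule free_separator[OF A2(1)])
  have sB2: "sfrag B2"
    by (rule free_sfrag[OF A2(1) B2])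
  have fA: "frag A" "atom A" and fA2: "frag A2" "atom A2"
    using A(1) A2(1) free_atom atom_frag by auto
  have e: "only_exit A y" "only_exit A2 y2"
    using A(1) A2(1) free_exit by auto
  define a where "a = card A"
  have k: "k = 2 * a + 1" "card A2 = a" "2 \<le> a"
    using fA(2) fA2(2) k_gt by (auto simp: atom_def a_def)
  have cy: "card (insert y A) = a + 1" "card (insert y2 A2) = a + 1"
    using card_free[OF A(1)] card_free[OF A2(1)] k by simp_all
  obtain x2 where x2: "x2 \<in> A2" "(x2, y2) \<in> Q"
    using A2(1) S_subset by (auto simp: free_def)
  have y2: "y2 \<notin> A2"
    using e(2) by (simp add: only_exit_def)
  have disjB: "B \<inter> nb B = {}"
    by (rule nb_disjoint)
  have y2B: "y2 \<in> B \<or> y2 \<in> nb B"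
    using nbI[of x2 y2 B] x2 A2(2) Q_subset by blast
  \<comment> \<open>Minimality of \<open>B\<close> in the form needed for crossing: such a corner
    would have \<open>insert y2 A2\<close> in its neighbourhood and be a smaller \<open>near\<close>
    fragment.\<close>
  have no: "\<not> (frag (B \<inter> C) \<and> nb (B \<inter> C) = corner B C)" if C: "C = B2 \<or> C = opp B2" for C
  proof
    assume f: "frag (B \<inter> C) \<and> nb (B \<inter> C) = corner B C"
    have nC: "nb C = nb B2" "C \<inter> nb B2 = {}"
      using C frag_opp(2)[OF B2(1)] nb_opp_disjoint[of B2] nb_disjoint[of B2] by auto
    have "insert y2 A2 \<subseteq> corner B C"
      unfolding corner_def nC(1) using B2(2) A2(2) y2B by blast
    then have "near (B \<inter> C)"
      unfolding near_def using f A2(1) fB(2) by (metis inf_assoc inf_bot_right inf_commute)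
    moreover have "B \<inter> C \<subset> B"
      using x2(1) A2(2) B2(2) nC(2) by blast
    then have "card (B \<inter> C) < card B"
      by (rule psubset_card_mono[OF frag_fin[OF fB(1)]])
    ultimately show False
      using B_min[of "B \<inter> C"] by linarith
  qed
  have no': "\<not> (frag (B \<inter> B2) \<and> nb (B \<inter> B2) = corner B B2)"
    "\<not> (frag (B \<inter> opp B2) \<and> nb (B \<inter> opp B2) = corner B (opp B2))"
    by (rule no, simp)+
  note big = sfrag_big[OF sB] sfrag_big[OF sfrag_opp[OF sB]] sfrag_big[OF sB2] sfrag_big[OF sfrag_opp[OF sB2]]
  show False
  proof (cases "nb B \<inter> nb B2 = {}")
    case False
    have "2 * card B + 1 = k"
      by (rule crossing_end(1)[OF fB(1) B2(1) no' big False])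
    then have "card B = card A2"
      using k by simp
    then have BA2: "A2 = B"
      using card_subset_eq[OF frag_fin[OF fB(1)] A2(2)] by simp
    note s = free_sep[OF A2(1) B2]
    \<comment> \<open>The \<open>a + 1\<close> vertices of \<open>insert y A\<close> do not fit into
      a half of size \<open>a\<close>. So this set meets \<open>nb B2\<close>, and it can do so only
      in \<open>y2\<close>.\<close>
    have in_side: False if "insert y A \<subseteq> C" "2 * card (nb A2 \<inter> C) + 1 = k" for C
    proof -
      have "insert y A \<subseteq> nb A2 \<inter> C"
        using that A(2) BA2 by simp
      then have "card (insert y A) \<le> card (nb A2 \<inter> C)"
        using finite_sub[OF nb_subset] by (intro card_mono) auto
      then show False
        using that(2) cy(1) k(1) by linarith
    qed
    have AA2: "insert y A \<subseteq> nb A2" "x2 \<notin> nb A2"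
      using A(2) BA2 x2(1) nb_disjoint[of A2] by auto
    have "insert y A \<inter> nb B2 \<noteq> {}"
      using free_side[OF A(1) B2(1)] in_side[OF _ s(2)] in_side[OF _ s(3)] by blast
    then obtain z where "z \<in> insert y A" "z \<in> nb A2 \<inter> nb B2"
      using AA2(1) by auto
    then have "y2 \<in> insert y A"
      unfolding s(1) by simp
    moreover have "y2 \<notin> A"
    proof
      assume "y2 \<in> A"
      moreover have "x2 \<notin> A" "x2 \<noteq> y"
        using AA2 by auto
      ultimately show False
        using only_exitD[OF e(1) Q_sym[OF x2(2)]] by blast
    qed
    ultimately have "y2 = y"
      by blast
    then have "only_exit A2 y"
      using e(2) by simp
    moreover have "A \<subseteq> nb A2"
      using AA2(1) by simp
    moreover have "2 * card A + 1 = k" "2 * card A2 + 1 = k"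
      using fA(2) fA2(2) by (simp_all add: atom_def)
    ultimately show False
      using same_exit[OF fA(1) _ e(1) fA2(1)] by blast
  next
    case disj: True
    have y2_in: "y2 \<in> B"
      using y2B disj B2(2) by blast
    have sub: "insert y2 A2 \<subseteq> B \<inter> nb B2"
      using y2_in A2(2) B2(2) by blast
    then have "card (insert y2 A2) \<le> card (B \<inter> nb B2)"
      using frag_fin[OF fB(1)] by (intro card_mono) auto
    then have ge: "k + 1 \<le> 2 * card (B \<inter> nb B2)"
      using cy(2) k(1) by linarith
    \<comment> \<open>\<open>B\<close> contains too much of \<open>nb B2\<close> for an ordinary
      crossing, so a whole side \<open>D\<close> of \<open>B2\<close> lies in \<open>nb B\<close>;
      counting then shows that it fills \<open>nb B\<close> together with \<open>A\<close> and
      \<open>y\<close>.\<close>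
    obtain D where D: "D = B2 \<or> D = opp B2" "D \<subseteq> nb B" "card D = a" "card (B \<inter> nb B2) = a + 1"
      by (rule crossing_disjoint[OF fB(1) B2(1) no' big(2-4) disj ge k(1)])
    have fD: "frag D" and nD: "nb D = nb B2"
      using D(1) B2(1) frag_opp[OF B2(1)] by auto
    have nDB: "nb D \<inter> B = insert y2 A2"
      using card_subset_eq[OF _ sub] D(4) cy(2) frag_fin[OF fB(1)] nD by (simp add: Int_commute)
    have nD2: "insert y2 A2 \<subseteq> nb D"
      using B2(2) nD by simp
    note s2 = free_sep[OF A2(1) fD nD2] and sA = free_sep[OF A(1) fB(1) A(2)]
    have sD: "sfrag D"
      by (rule free_sfrag[OF A2(1) fD nD2])
    have atD: "atom D"
      unfolding atom_def using sD D(3) k(1) by blast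
    have finD: "finite D"
      by (rule frag_fin[OF fD])
    have "insert y A \<inter> nb D = {}"
      using A(2) disj nD by blast
    then have "insert y A \<subseteq> D \<or> insert y A \<subseteq> opp D"
      by (rule free_side[OF A(1) fD])
    moreover have "\<not> insert y A \<subseteq> D"
      using card_mono[OF finD, of "insert y A"] cy(1) D(3) by auto
    ultimately have AD: "insert y A \<inter> D = {}"
      using opp_disjoint[of D] by blast
    have "finite (insert y A)"
      using frag_fin[OF fA(1)] by simp
    then have "card (insert y A \<union> D) = k"
      using card_Un_disjoint[OF _ finD AD] cy(1) D(3) k(1) by simp
    then have "insert y A \<union> D = nb B"
      using card_subset_eq[OF finite_sub[OF nb_subset], of "insert y A \<union> D" B] A(2) D(2) frag_nb[OF fB(1)]
      by simp
    then have nB: "nb B = insert y (A \<union> D)"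
      by simp
    have "nb A2 \<inter> D = D"
      using card_subset_eq[OF finD, of "nb A2 \<inter> D"] s2(2) D(3) k(1) by simp
    then have DA2: "D \<subseteq> nb A2"
      by blast
    have y2A2: "y2 \<in> nb A2"
      using s2(1) by blast
    \<comment> \<open>The argument of the first case with the atom \<open>D\<close> in place of
      \<open>A2\<close>: \<open>insert y2 A2\<close> is too large for a half of \<open>nb D\<close>,
      so the separator \<open>X\<close> meets it, namely in the exit \<open>v\<close>.\<close>
    have exitS: "v = y2" if dv: "(d, v) \<in> S" "d \<in> D" "v \<notin> D" for d v
    proof -
      obtain X where X: "frag X" "d \<in> nb X" "v \<in> nb X"
        using S_sep[OF dv(1)] by blast
      note sX = atom_sep[OF atD dv X]
      have in_side: False if "insert y2 A2 \<subseteq> C" "2 * card (nb D \<inter> C) + 1 = k" for C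
      proof -
        have "insert y2 A2 \<subseteq> nb D \<inter> C"
          using that nD2 by simp
        then have "card (insert y2 A2) \<le> card (nb D \<inter> C)"
          using finite_sub[OF nb_subset] by (intro card_mono) auto
        then show False
          using that(2) cy(2) k(1) by linarith
      qed
      have "insert y2 A2 \<inter> nb X \<noteq> {}"
        using free_side[OF A2(1) X(1)] in_side[OF _ sX(3)] in_side[OF _ sX(4)] by blast
      then obtain z where "z \<in> insert y2 A2" "z \<in> nb D \<inter> nb X"
        using nD2 by auto
      then have "v \<in> insert y2 A2"
        unfolding sX(2) by simp
      moreover have "v \<notin> A2"
      proof
        assume "v \<in> A2"
        moreover have "d \<notin> A2" "d \<noteq> y2"
          using dv(2) nD2 nb_disjoint[of D] by auto
        moreover have "(v, d) \<in> Q"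
          using dv(1) S_subset Q_sym by blast
        ultimately show False
          using only_exitD[OF e(2)] by blast
      qed
      ultimately show ?thesis
        by blast
    qed
    show False
    \<comment> \<open>If \<open>y2\<close> is the only exit of \<open>D\<close>, then
      \<open>D\<close> and \<open>A2\<close> are adjacent sets with a common exit. Otherwise the
      exceptional edge leaves \<open>D\<close>, so \<open>U\<close> is nonempty and
      \<open>big_all\<close> becomes available.\<close>
    proof (cases "\<forall>d v. d \<in> D \<longrightarrow> v \<notin> D \<longrightarrow> (d, v) \<in> Q \<longrightarrow> v = y2")
      case True
      have "y2 \<in> V - D"
        using nD2 nb_subset[of D] nb_disjoint[of D] by blast
      then have "only_exit D y2"
        using True frag_V[OF fD] by (simp add: only_exit_def)
      moreover have "2 * card D + 1 = k" "2 * card A2 + 1 = k"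
        using D(3) k by simp_all
      ultimately show False
        using same_exit[OF fD _ _ fA2(1) _ e(2) DA2] by blast
    next
      case False
      then obtain z w where "z \<in> D" "w \<notin> D" "(z, w) \<in> Q" "w \<noteq> y2"
        by blast
      then have U: "U \<noteq> {}"
        using exitS not_S by blast
      \<comment> \<open>Even the exceptional edge does not lead into \<open>B\<close>, which avoids
        \<open>U\<close>.\<close>
      have exitD: "v = y2" if "(d, v) \<in> Q" "d \<in> D" "v \<in> B" for d v
      proof (cases "(d, v) \<in> S")
        case True
        then show ?thesis
          using exitS that D(2) disjB by blast
      next
        case False
        then show ?thesis
          using not_S that fB(2) by blast
      qed
      have "A \<inter> D = {}" "y \<notin> D"
        using AD by auto
      have apart: "A \<inter> nb A2 = {}"
        by (rule atoms_apart[OF U fB(1) nB A(1) fA2(2) A2(2) y2_in y2A2 _ finD DA2 nDB])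
          (use D(3) k(1) AD in auto)
      \<comment> \<open>Otherwise \<open>nb A2\<close> has at most \<open>a + 2\<close> elements,
        fewer than \<open>2 * a + 1\<close> since \<open>a \<ge> 2\<close>.\<close>
      have "\<not> nb A2 \<inter> B \<subseteq> {y2}"
      proof
        assume h: "nb A2 \<inter> B \<subseteq> {y2}"
        have "nb A2 \<subseteq> B \<union> nb B"
          using A2(2) nbI[of _ _ B] by (auto simp: nb_def)
        then have "nb A2 \<subseteq> insert y2 (insert y D)"
          using h nB apart by blast
        then have "card (nb A2) \<le> card (insert y2 (insert y D))"
          using finD by (intro card_mono) auto
        also have "\<dots> \<le> a + 2"
          using D(3) finD by (simp add: card_insert_if)
        finally show False
          using frag_nb[OF fA2(1)] k by simp
      qed
      then obtain h where h: "h \<in> nb A2" "h \<in> B" "h \<noteq> y2"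
        by blast
      have "\<not> nb A \<inter> B \<subseteq> {y2}"
      proof
        assume "nb A \<inter> B \<subseteq> {y2}"
        then have "card (nb A \<inter> B) \<le> 1"
          using card_mono[of "{y2}" "nb A \<inter> B"] by simp
        then show False
          using sA(2) k by linarith
      qed
      then obtain c where c: "c \<in> nb A" "c \<in> B" "c \<noteq> y2"
        by blast
      have "c \<notin> A2"
      proof
        assume c2: "c \<in> A2"
        obtain u where u: "u \<in> A" "(u, c) \<in> E"
          using c(1) by (auto simp: nb_def)
        have "u \<notin> A2"
          using u(1) A(2) A2(2) disjB by blast
        then have "u \<in> nb A2"
          using nbI[of c u A2] c2 u E_sym by blast
        then show False
          using apart u(1) by blast
      qed
      have "nb A \<inter> opp B \<noteq> {}"
        using sA(3) k by auto
      then obtain c' where c': "c' \<in> nb A" "c' \<in> opp B"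
        by blast
      show False
        by (rule no_straddling_separator[OF fB(1) nB \<open>A \<inter> D = {}\<close> \<open>y \<notin> D\<close> e(1) e(2) A2(2) y2_in DA2 frag_ne[OF fD] exitD
              c(1,2) \<open>c \<notin> A2\<close> c(3) c' h])
    qed
  qed
qed

end

section \<open>Components and contraction\<close>

text \<open>The closure is reflexive everywhere, also at deleted vertices; membership in
  \<open>pverts H - T\<close> is therefore always stated separately.\<close>

definition reach :: "'a pair_pre_digraph \<Rightarrow> 'a set \<Rightarrow> ('a \<times> 'a) set" where
  "reach H T = {(u, v) \<in> parcs H. u \<in> pverts H - T \<and> v \<in> pverts H - T}\<^sup>*"

lemma arcs_ends_delete_verts:
  "arcs_ends (delete_verts H T) = {(u, v) \<in> parcs H. u \<in> pverts H - T \<and> v \<in> pverts H - T}"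
  by (auto simp: delete_verts_def arcs_ends_conv image_def)

lemma verts_delete_verts: "verts (delete_verts H T) = pverts H - T"
  by (simp add: delete_verts_def)

lemma wf_delete_verts: "wf_digraph (delete_verts H T)"
  by unfold_locales (auto simp: delete_verts_def)

lemma reachable_delete_verts:
  "u \<rightarrow>\<^sup>*\<^bsub>delete_verts H T\<^esub> v \<longleftrightarrow> u \<in> pverts H - T \<and> v \<in> pverts H - T \<and> (u, v) \<in> reach H T"
proof -
  interpret wf_digraph "delete_verts H T"
    by (rule wf_delete_verts)
  show ?thesis
    unfolding reachable_conv arcs_ends_delete_verts verts_delete_verts reach_def by auto
qed

lemma symmetric_delete_verts: "sym (parcs H) \<Longrightarrow> symmetric (delete_verts H T)"
  unfolding symmetric_def arcs_ends_delete_verts by (auto simp: sym_def)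

lemma connected_delete_verts:
  assumes "sym (parcs H)"
  shows "connected (delete_verts H T) \<longleftrightarrow>
    pverts H - T \<noteq> {} \<and> (\<forall>u\<in>pverts H - T. \<forall>v\<in>pverts H - T. (u, v) \<in> reach H T)"
proof -
  interpret wf_digraph "delete_verts H T"
    by (rule wf_delete_verts)
  show ?thesis
    unfolding connected_def strongly_connected_def reachable_mk_symmetric_eq[OF symmetric_delete_verts[OF assms]]
    by (auto simp: verts_delete_verts reachable_delete_verts)
qed

lemma reach_refl: "(u, u) \<in> reach H T"
  by (simp add: reach_def)

lemma reach_trans: "(u, v) \<in> reach H T \<Longrightarrow> (v, w) \<in> reach H T \<Longrightarrow> (u, w) \<in> reach H T"
  unfolding reach_def by (rule rtrancl_trans)

lemma reach_sym: "sym (parcs H) \<Longrightarrow> (u, v) \<in> reach H T \<Longrightarrow> (v, u) \<in> reach H T"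
proof -
  assume "sym (parcs H)" and uv: "(u, v) \<in> reach H T"
  then have "sym (reach H T)"
    unfolding reach_def by (intro sym_rtrancl) (auto simp: sym_def)
  then show ?thesis
    using uv by (auto dest: symD)
qed

lemma reach_closed:
  assumes "(u, v) \<in> reach H T" "u \<in> X"
    and "\<And>a b. a \<in> X \<Longrightarrow> (a, b) \<in> parcs H \<Longrightarrow> b \<in> pverts H - T \<Longrightarrow> b \<in> X"
  shows "v \<in> X"
  using assms(1,2) unfolding reach_def
  by (induction rule: rtrancl_induct) (use assms(3) in auto)

definition comp_of :: "'a pair_pre_digraph \<Rightarrow> 'a set \<Rightarrow> 'a \<Rightarrow> 'a set" where
  "comp_of H T u = {v \<in> pverts H - T. (u, v) \<in> reach H T}"

lemma comp_of_component:
  assumes "sym (parcs H)" "u \<in> pverts H - T"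
  shows "comp_of H T u \<in> components (delete_verts H T)"
  unfolding components_def pre_digraph.sccs_verts_def reachable_delete_verts mem_Collect_eq
proof (intro conjI ballI allI impI)
  show "comp_of H T u \<noteq> {}"
    using assms(2) reach_refl[of u H T] by (auto simp: comp_of_def)
next
  fix v w assume v: "v \<in> comp_of H T u" and w: "w \<in> comp_of H T u"
  then show "v \<in> pverts H - T" "w \<in> pverts H - T"
    by (simp_all add: comp_of_def)
  have "(v, u) \<in> reach H T"
    using v by (auto simp: comp_of_def intro: reach_sym[OF assms(1)])
  then show "(v, w) \<in> reach H T"
    using w by (auto simp: comp_of_def intro: reach_trans)
next
  fix v w assume v: "v \<in> comp_of H T u" and w: "w \<notin> comp_of H T u"
  have "(v, w) \<notin> reach H T" if "w \<in> pverts H - T"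
    using v w that reach_trans[of u v H T w] by (auto simp: comp_of_def)
  then show "\<not> (v \<in> pverts H - T \<and> w \<in> pverts H - T \<and> (v, w) \<in> reach H T) \<or>
      \<not> (w \<in> pverts H - T \<and> v \<in> pverts H - T \<and> (w, v) \<in> reach H T)"
    by blast
qed

text \<open>Turns a vertex list into the arc list on which the library notions of walk and cycle are
  based.\<close>

lemma zip_tl_walk:
  assumes "walk R q" "q \<noteq> []"
  shows "set (zip q (tl q)) \<subseteq> R" "pcas (hd q) (zip q (tl q)) (last q)" "pawalk_verts (hd q) (zip q (tl q)) = q"
proof -
  have "set (zip q (tl q)) \<subseteq> R \<and> pcas (hd q) (zip q (tl q)) (last q) \<and> pawalk_verts (hd q) (zip q (tl q)) = q"
    using assms
  proof (induction q)
    case (Cons a q)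
    then show ?case
      by (cases q) (auto simp: walk_def)
  qed simp
  then show "set (zip q (tl q)) \<subseteq> R" "pcas (hd q) (zip q (tl q)) (last q)" "pawalk_verts (hd q) (zip q (tl q)) = q"
    by auto
qed

text \<open>A path from \<open>z\<close> to \<open>z'\<close> that avoids \<open>x\<close> closes up
  through \<open>x\<close> to a cycle. Since \<open>z \<noteq> z'\<close> it has at least 3 arcs, so
  it is a cycle forbidden by \<open>undirected_tree\<close>.\<close>

lemma undirected_tree_unique_neighbour:
  assumes Q: "undirected_tree Q" and z: "(x, z) \<in> parcs Q" "(x, z') \<in> parcs Q"
    and conn: "(z, z') \<in> (avoid (parcs Q) x)\<^sup>*"
  shows "z = z'"
proof (rule ccontr)
  assume ne: "z \<noteq> z'"
  interpret pair_graph Q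
    using Q by (simp add: undirected_tree_def)
  obtain p where p: "p \<noteq> []" "hd p = z" "last p = z'" "distinct p" "walk (avoid (parcs Q) x) p"
    using path_exists[OF conn] by blast
  have "z \<noteq> x"
    using no_loops' z(1) by blast
  have xp: "x \<notin> set p"
  proof
    assume "x \<in> set p"
    then have "set p \<subseteq> {x}"
      by (intro walk_const[OF p(5), of _ x]) (auto simp: avoid_def)
    then show False
      using p(1,2) \<open>z \<noteq> x\<close> hd_in_set[OF p(1)] by auto
  qed
  have "walk (parcs Q) p"
    using p(5) unfolding walk_def by (rule successively_mono) (auto simp: avoid_def)
  moreover have "(z', x) \<in> parcs Q"
    using arcs_symmetric z(2) by blast
  ultimately have w: "walk (parcs Q) ([x] @ p @ [x])"
    using z(1) p(1-3) unfolding walk_def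
    by (simp add: successively_Cons successively_append_iff hd_append)
  define q where "q = [x] @ p @ [x]"
  have q: "q \<noteq> []" "hd q = x" "last q = x" "tl q = p @ [x]"
    by (auto simp: q_def)
  note c = zip_tl_walk[OF w[folded q_def] q(1), unfolded q(2,3)]
  obtain u l where ul: "p = u # l"
    using p(1) by (cases p) simp_all
  then have "l \<noteq> []"
    using p(2,3) ne by auto
  then have "1 \<le> length l"
    by (cases l) simp_all
  moreover have l_zip: "length (zip q (tl q)) = length l + 2"
    by (simp add: q_def ul)
  ultimately have len: "length (zip q (tl q)) \<ge> 3"
    by simp
  have nonempty: "zip q (tl q) \<noteq> []"
    using l_zip by (metis list.size(3) add_is_0 zero_neq_numeral)
  have "x \<in> pverts Q"
    using z(1) in_arcsD1 by blast
  then have "cycle (zip q (tl q))"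
    unfolding cycle_def awalk_def using c nonempty q(4) p(4) xp
    by (intro exI[of _ x] conjI) simp_all
  then show False
    using Q len unfolding undirected_tree_def by blast
qed

section \<open>Separating sets, fragments and noncontractible edges of a pair graph\<close>

lemma pair_graph_basic:
  assumes "pair_graph G"
  shows "finite (pverts G)" "parcs G \<subseteq> pverts G \<times> pverts G" "sym (parcs G)" "(x, x) \<notin> parcs G"
proof -
  interpret pair_graph G by fact
  show "finite (pverts G)"
    by simp
  show "parcs G \<subseteq> pverts G \<times> pverts G"
    using wellformed' by auto
  show "sym (parcs G)"
    using arcs_symmetric by (auto intro: symI)
  show "(x, x) \<notin> parcs G"
    using no_loops' by blast
qed

lemma k_connected_graphI:
  assumes G: "pair_graph G" and k: "k_connected k G"
  shows "k_connected_graph (pverts G) (parcs G) k"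
proof -
  note b = pair_graph_basic[OF G]
  interpret separated_graph "pverts G" "parcs G" k
    using b by unfold_locales
  show ?thesis
  proof
    fix X assume X: "X \<subseteq> pverts G" "X \<noteq> {}" "opp X \<noteq> {}"
    show "k \<le> card (nb X)"
    proof (rule ccontr)
      assume "\<not> ?thesis"
      then have "connected (delete_verts G (nb X))"
        using k nb_subset by (simp add: k_connected_def)
      moreover obtain u v where uv: "u \<in> X" "v \<in> opp X"
        using X by blast
      moreover have "u \<in> pverts G - nb X" "v \<in> pverts G - nb X"
        using uv X(1) by (auto simp: nb_def opp_def)
      ultimately have "(u, v) \<in> reach G (nb X)"
        using connected_delete_verts[OF b(3)] by blast
      then have "v \<in> X"
        by (rule reach_closed[OF _ uv(1)]) (use nbI in blast)
      then show False
        using uv(2) by (simp add: opp_def)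
    qed
  qed
qed

text \<open>Take a component \<open>X\<close> of \<open>G - T\<close>. Its neighbourhood lies in
  \<open>T\<close> and has at least \<open>k\<close> elements, so it is all of
  \<open>T\<close>.\<close>

lemma separator_of_frag:
  assumes G: "pair_graph G" and k: "k_connected k G"
    and T: "T \<subseteq> pverts G" "card T = k" "\<not> connected (delete_verts G T)"
  shows "\<exists>X. separated_graph.frag (pverts G) (parcs G) k X \<and> separated_graph.nb (pverts G) (parcs G) X = T"
proof -
  note b = pair_graph_basic[OF G]
  interpret k_connected_graph "pverts G" "parcs G" k
    by (rule k_connected_graphI[OF G k])
  have "pverts G - T \<noteq> {}"
  proof
    assume "pverts G - T = {}"
    then have "card (pverts G) \<le> card T"
      using b(1) T(1) by (intro card_mono) (auto intro: finite_subset)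
    then show False
      using k T(2) by (simp add: k_connected_def)
  qed
  then obtain u v where uv: "u \<in> pverts G - T" "v \<in> pverts G - T" "(u, v) \<notin> reach G T"
    using T(3) connected_delete_verts[OF b(3)] by blast
  define X where "X = comp_of G T u"
  have X: "X \<subseteq> pverts G" "u \<in> X" "v \<notin> X"
    using uv reach_refl[of u G T] by (auto simp: X_def comp_of_def)
  have sub: "nb X \<subseteq> T"
  proof
    fix w assume "w \<in> nb X"
    then obtain x where x: "x \<in> X" "(x, w) \<in> parcs G" "w \<in> pverts G" "w \<notin> X"
      by (auto simp: nb_def)
    show "w \<in> T"
    proof (rule ccontr)
      assume "w \<notin> T"
      then have "(x, w) \<in> reach G T"
        using x by (auto simp: reach_def X_def comp_of_def)
      then have "w \<in> X"
        using x \<open>w \<notin> T\<close> reach_trans[of u x G T w] by (auto simp: X_def comp_of_def)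
      then show False
        using x(4) by blast
    qed
  qed
  have o: "opp X \<noteq> {}"
    using uv(2) X(3) sub by (auto simp: opp_def)
  have "k \<le> card (nb X)"
    using k_le[OF X(1) _ o] X(2) by blast
  then have "nb X = T"
    using card_seteq[OF _ sub] T(1,2) b(1) finite_subset by metis
  then show ?thesis
    unfolding frag_def using X o T(2) by blast
qed

lemma frag_T_fragment:
  assumes G: "pair_graph G" and k: "k_connected k G" "connectivity G = k"
    and X: "separated_graph.frag (pverts G) (parcs G) k X"
  shows "T_fragment G (separated_graph.nb (pverts G) (parcs G) X) X"
proof -
  note b = pair_graph_basic[OF G]
  interpret k_connected_graph "pverts G" "parcs G" k
    by (rule k_connected_graphI[OF G k(1)])
  have X': "X \<subseteq> pverts G" "X \<noteq> {}" "opp X \<noteq> {}" "card (nb X) = k"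
    using X by (auto simp: frag_def)
  obtain v where v: "v \<in> opp X"
    using X' by blast
  then have v': "v \<in> pverts G - nb X" "v \<notin> X"
    by (auto simp: opp_def)
  have XT: "X \<subseteq> pverts G - nb X"
    using X'(1) nb_disjoint by blast
  have comp_sub: "comp_of G (nb X) x \<subseteq> X" if "x \<in> X" for x
  proof
    fix w assume "w \<in> comp_of G (nb X) x"
    then have "(x, w) \<in> reach G (nb X)"
      by (simp add: comp_of_def)
    then show "w \<in> X"
      by (rule reach_closed[OF _ that]) (use nbI in blast)
  qed
  have self: "x \<in> comp_of G (nb X) x" if "x \<in> pverts G - nb X" for x
    using that by (simp add: comp_of_def reach_refl)
  have "\<not> connected (delete_verts G (nb X))"
  proof
    assume "connected (delete_verts G (nb X))"
    moreover obtain x where x: "x \<in> X"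
      using X' by blast
    ultimately have "(x, v) \<in> reach G (nb X)"
      using connected_delete_verts[OF b(3)] XT v'(1) by blast
    then have "v \<in> comp_of G (nb X) x"
      using v'(1) by (simp add: comp_of_def)
    then show False
      using comp_sub[OF x] v'(2) by blast
  qed
  then have T: "nb X \<in> smallest_separating_sets G"
    using X'(4) k(2) nb_subset by (simp add: smallest_separating_sets_def)
  \<comment> \<open>The components of the vertices of \<open>X\<close>; that of \<open>v\<close> is
    not among them, so the family is proper.\<close>
  define \<C> where "\<C> = comp_of G (nb X) ` X"
  have "\<C> \<subseteq> components (delete_verts G (nb X))"
    unfolding \<C>_def using comp_of_component[OF b(3)] XT by blast
  moreover have "comp_of G (nb X) v \<in> components (delete_verts G (nb X))"
    by (rule comp_of_component[OF b(3) v'(1)])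
  moreover have "comp_of G (nb X) v \<notin> \<C>"
    unfolding \<C>_def using self[OF v'(1)] comp_sub v'(2) by auto
  moreover have "\<C> \<noteq> {}"
    using X'(2) by (simp add: \<C>_def)
  moreover have "X = \<Union>\<C>"
    unfolding \<C>_def using comp_sub self XT by blast
  ultimately show ?thesis
    unfolding T_fragment_def using T by blast
qed

text \<open>\<open>G/e\<close> still has more than \<open>k\<close> vertices, so it has a separating
  set with fewer than \<open>k\<close> elements. Its preimage separates \<open>G\<close>, hence has
  \<open>k\<close> elements and contains both ends of \<open>e\<close>.\<close>

lemma noncontractible_separator:
  assumes G: "pair_graph G" and k: "k_connected k G" and card_V: "k + 2 \<le> card (pverts G)"
    and xy: "(x, y) \<in> parcs G" and nc: "\<not> k_contractible k G {x, y}"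
  shows "\<exists>T. T \<subseteq> pverts G \<and> card T = k \<and> \<not> connected (delete_verts G T) \<and> x \<in> T \<and> y \<in> T"
proof -
  note b = pair_graph_basic[OF G]
  let ?e = "{x, y}"
  let ?H = "contract G ?e"
  let ?f = "contract_vertex ?e"
  have V: "x \<in> pverts G" "y \<in> pverts G" "x \<noteq> y"
    using b xy by auto
  have H: "pverts ?H = ?f ` pverts G"
    "parcs ?H = {(?f u, ?f v) |u v. (u, v) \<in> parcs G \<and> ?f u \<noteq> ?f v}"
    by (simp_all add: contract_def)
  have f_eq: "?f u = ?e \<longleftrightarrow> u \<in> ?e" for u
    using V(3) by (auto simp: contract_vertex_def)
  have inj: "inj_on ?f (pverts G - {x})"
    by (auto simp: inj_on_def contract_vertex_def split: if_splits)
  have "card (?f ` (pverts G - {x})) = card (pverts G) - 1"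
    using card_image[OF inj] V(1) by simp
  moreover have "card (?f ` (pverts G - {x})) \<le> card (?f ` pverts G)"
    using b(1) by (intro card_mono) auto
  ultimately have card_H: "k < card (pverts ?H)"
    using card_V unfolding H(1) by linarith
  have symH: "sym (parcs ?H)"
  proof (rule symI)
    fix c d assume "(c, d) \<in> parcs ?H"
    then obtain u v where uv: "c = ?f u" "d = ?f v" "(u, v) \<in> parcs G" "?f u \<noteq> ?f v"
      unfolding H(2) by blast
    have "(v, u) \<in> parcs G"
      using uv(3) b(3) by (auto dest: symD)
    then show "(d, c) \<in> parcs ?H"
      unfolding H(2) uv(1,2) using uv(4) by fastforce
  qed
  have "?e \<in> edges G"
    using xy by (auto simp: edges_def)
  then have "\<not> k_connected k ?H"
    using nc k by (simp add: k_contractible_def)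
  then obtain T' where T': "T' \<subseteq> pverts ?H" "card T' < k" "\<not> connected (delete_verts ?H T')"
    using card_H by (auto simp: k_connected_def)
  have finT': "finite T'"
    using finite_subset[OF T'(1)[unfolded H(1)]] b(1) by simp
  define T where "T = {v \<in> pverts G. ?f v \<in> T'}"
  have TV: "T \<subseteq> pverts G" "finite T"
    using b(1) by (auto simp: T_def)
  have disc: "\<not> connected (delete_verts G T)"
  proof
    assume "connected (delete_verts G T)"
    then have conn: "pverts G - T \<noteq> {}" "\<And>u v. u \<in> pverts G - T \<Longrightarrow> v \<in> pverts G - T \<Longrightarrow> (u, v) \<in> reach G T"
      using connected_delete_verts[OF b(3)] by blast+
    have step: "(?f u, ?f v) \<in> reach ?H T'" if "(u, v) \<in> reach G T" for u v
      using that unfolding reach_def[of G]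
    proof (induction rule: rtrancl_induct)
      case base
      show ?case
        by (rule reach_refl)
    next
      case (step v w)
      then have vw: "(v, w) \<in> parcs G" "v \<in> pverts G" "w \<in> pverts G" "?f v \<notin> T'" "?f w \<notin> T'"
        by (auto simp: T_def)
      have "(?f v, ?f w) \<in> reach ?H T'"
      proof (cases "?f v = ?f w")
        case False
        then have "(?f v, ?f w) \<in> parcs ?H" "?f v \<in> pverts ?H" "?f w \<in> pverts ?H"
          unfolding H using vw by blast+
        then show ?thesis
          unfolding reach_def using vw by blast
      qed (simp add: reach_refl)
      then show ?case
        by (rule reach_trans[OF step.IH])
    qed
    have pre: "\<exists>u. u \<in> pverts G - T \<and> u' = ?f u" if "u' \<in> pverts ?H - T'" for u'
      using that unfolding H(1) T_def by blast
    have "pverts ?H - T' \<noteq> {}"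
      using conn(1) unfolding H(1) T_def by blast
    moreover have "(u', v') \<in> reach ?H T'" if "u' \<in> pverts ?H - T'" "v' \<in> pverts ?H - T'" for u' v'
      using pre[OF that(1)] pre[OF that(2)] conn(2) step by blast
    ultimately show False
      using T'(3) connected_delete_verts[OF symH] by blast
  qed
  have ge: "k \<le> card T"
    using disc k TV(1) unfolding k_connected_def by (meson not_less)
  have img: "?f ` T \<subseteq> T'"
    by (auto simp: T_def)
  \<comment> \<open>The contraction merges nothing but \<open>x\<close> and \<open>y\<close>. If the
    merged vertex were not in \<open>T'\<close>, then \<open>T\<close> would be no larger than
    \<open>T'\<close>, hence smaller than \<open>k\<close>.\<close>
  have e: "?e \<in> T'"
  proof (rule ccontr)
    assume "?e \<notin> T'"
    then have "x \<notin> T"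
      using f_eq[of x] by (auto simp: T_def)
    then have "inj_on ?f T"
      using TV(1) by (intro inj_on_subset[OF inj]) blast
    then have "card T \<le> card T'"
      using card_inj_on_le img finT' by blast
    then show False
      using ge T'(2) by simp
  qed
  then have xyT: "x \<in> T" "y \<in> T"
    using f_eq[of x] f_eq[of y] V by (auto simp: T_def)
  have "inj_on ?f (T - {x})"
    using TV(1) by (intro inj_on_subset[OF inj]) blast
  then have "card (T - {x}) \<le> card T'"
    using card_inj_on_le[of ?f "T - {x}" T'] img finT' by blast
  then have "card T \<le> k"
    using T'(2) TV(2) xyT(1) by simp
  then show ?thesis
    using ge TV(1) disc xyT by (intro exI[of _ T]) simp
qed

section \<open>The value of the connectivity, and the assembly of the theorem\<close>

lemma k_connected_connectivity:
  assumes "finite (pverts G)" "pverts G \<noteq> {}"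
  shows "k_connected (connectivity G) G"
  unfolding connectivity_def
proof (rule GreatestI_nat)
  show "k_connected 0 G"
    using assms by (simp add: k_connected_def card_gt_0_iff)
  show "n \<le> card (pverts G)" if "k_connected n G" for n
    using that by (simp add: k_connected_def)
qed

text \<open>Deleting all vertices but two nonadjacent ones leaves a disconnected graph.\<close>

lemma card_noncomplete:
  assumes G: "pair_graph G" and k: "k_connected k G"
    and nc: "\<not> complete_digraph (card (pverts G)) (with_proj G)"
  shows "k + 2 \<le> card (pverts G)"
proof (rule ccontr)
  assume small: "\<not> ?thesis"
  note b = pair_graph_basic[OF G]
  have "parcs G \<noteq> {(u, v). (u, v) \<in> pverts G \<times> pverts G \<and> u \<noteq> v}"
    using nc pair_graph.pair_graphD_graph[OF G] by (simp add: complete_digraph_def)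
  then obtain u v where uv: "u \<in> pverts G" "v \<in> pverts G" "u \<noteq> v" "(u, v) \<notin> parcs G"
    using b(2,4) by auto
  define T where "T = pverts G - {u, v}"
  have "card (pverts G) \<ge> 2"
    using card_mono[of "pverts G" "{u, v}"] b(1) uv by simp
  then have "card T < k"
    using small b(1) uv card_Diff_subset[of "{u, v}" "pverts G"] by (simp add: T_def)
  then have "connected (delete_verts G T)"
    using k by (auto simp: k_connected_def T_def)
  moreover have "pverts G - T = {u, v}"
    using uv by (auto simp: T_def)
  ultimately have "(u, v) \<in> reach G T"
    using connected_delete_verts[OF b(3)] by blast
  then have "v \<in> {u}"
    by (rule reach_closed) (use \<open>pverts G - T = {u, v}\<close> uv(4) in auto)
  then show False
    using uv(3) by simp
qed

text \<open>The common core of both parts: in part (i) \<open>F\<close> is empty and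
  \<open>big\<close> is vacuous, in part (ii) \<open>F\<close> has at most one element.\<close>

lemma dfs_tree_at_most_one_contractible:
  assumes G: "pair_graph G" and nc: "\<not> complete_digraph (card (pverts G)) (with_proj G)"
    and k: "connectivity G = k" "3 < k" and Q: "DFS_tree G Q r"
    and F: "F = {e \<in> edges Q. k_contractible k G e}" "F = {} \<or> F = {f}"
    and big_S: "\<And>X. S_fragment G (edges Q) X \<Longrightarrow> k \<le> 2 * card X + 1"
    and big: "F \<noteq> {} \<Longrightarrow> (\<And>X. fragment G X \<Longrightarrow> k \<le> 2 * card X + 1)"
  shows False
proof -
  note b = pair_graph_basic[OF G]
  have tree: "undirected_tree Q" and span: "spanning (with_proj Q) (with_proj G)" and r: "r \<in> pverts Q"
    and dfs: "\<And>x A B a b. x \<in> pverts Q \<Longrightarrow> A \<in> branches Q r x \<Longrightarrow> B \<in> branches Q r x \<Longrightarrow> A \<noteq> B \<Longrightarrow>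
      a \<in> A \<Longrightarrow> b \<in> B \<Longrightarrow> (a, b) \<notin> parcs G"
    using Q by (auto simp: DFS_tree_def)
  have Q_graph: "pair_graph Q" and Q_conn: "connected (with_proj Q)"
    using tree by (auto simp: undirected_tree_def)
  note q = pair_graph_basic[OF Q_graph]
  have VQ: "pverts Q = pverts G" and QE: "parcs Q \<subseteq> parcs G"
    using span by (auto simp: spanning_def subgraph_def)
  have kc: "k_connected k G"
    using k_connected_connectivity[OF b(1)] r VQ k(1) by auto
  have card_V: "k + 2 \<le> card (pverts G)"
    by (rule card_noncomplete[OF G kc nc])
  interpret GK: k_connected_graph "pverts G" "parcs G" k
    by (rule k_connected_graphI[OF G kc])
  have avoid_eq: "reach Q {x} = (avoid (parcs Q) x)\<^sup>*" for x
  proof -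
    have "{(u, v) \<in> parcs Q. u \<in> pverts Q - {x} \<and> v \<in> pverts Q - {x}} = avoid (parcs Q) x"
      using q(2) by (auto simp: avoid_def)
    then show ?thesis
      by (simp add: reach_def)
  qed
  have conn: "(u, v) \<in> (parcs Q)\<^sup>*" if "u \<in> pverts G" "v \<in> pverts G" for u v
  proof -
    have "with_proj Q = delete_verts Q {}"
      using q(2) by (auto simp: with_proj_def delete_verts_def induce_subgraph_def)
    then have "(u, v) \<in> reach Q {}"
      using Q_conn connected_delete_verts[OF q(3), of "{}"] that VQ by simp
    moreover have "{(u, v) \<in> parcs Q. u \<in> pverts Q - {} \<and> v \<in> pverts Q - {}} = parcs Q"
      using q(2) by auto
    ultimately show ?thesis
      by (simp add: reach_def)
  qed
  define S where "S = {(x, y) \<in> parcs Q. {x, y} \<notin> F}"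
  \<comment> \<open>As edges are sets of endvertices, this union is the single contractible edge, or
    empty.\<close>
  define U where "U = \<Union>F"
  have frag_T: "T_fragment G (GK.nb X) X" if "GK.frag X" for X
    by (rule frag_T_fragment[OF G kc k(1) that])
  interpret covered_dfs_tree "pverts G" "parcs G" k "parcs Q" r S U
  proof
    show "parcs Q \<subseteq> parcs G" "sym (parcs Q)" "r \<in> pverts G" "3 < k"
      using QE q(3) r VQ k(2) by simp_all
    show "(x, x) \<notin> parcs Q" for x
      by (rule q(4))
    show "(u, v) \<in> (parcs Q)\<^sup>*" if "u \<in> pverts G" "v \<in> pverts G" for u v
      by (rule conn[OF that])
    show "z = z'" if "(x, z) \<in> parcs Q" "(x, z') \<in> parcs Q" "(z, z') \<in> (avoid (parcs Q) x)\<^sup>*" for x z z'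
      by (rule undirected_tree_unique_neighbour[OF tree that])
    show "(a, b) \<notin> parcs G" if x: "x \<in> pverts G" and ne: "a \<noteq> x" "b \<noteq> x"
      and n: "(a, r) \<notin> (avoid (parcs Q) x)\<^sup>*" "(b, r) \<notin> (avoid (parcs Q) x)\<^sup>*" "(a, b) \<notin> (avoid (parcs Q) x)\<^sup>*"
      for x a b
    proof
      assume ab: "(a, b) \<in> parcs G"
      then have V: "a \<in> pverts Q - {x}" "b \<in> pverts Q - {x}"
        using b(2) ne VQ by auto
      have "comp_of Q {x} a \<in> branches Q r x" "comp_of Q {x} b \<in> branches Q r x"
        unfolding branches_def using comp_of_component[OF q(3) V(1)] comp_of_component[OF q(3) V(2)] n
        by (simp_all add: comp_of_def avoid_eq)
      moreover have in_comp: "a \<in> comp_of Q {x} a" "b \<in> comp_of Q {x} b"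
        using V by (simp_all add: comp_of_def reach_refl)
      moreover have "b \<notin> comp_of Q {x} a"
        using n(3) by (simp add: comp_of_def avoid_eq)
      ultimately show False
        using dfs[of x "comp_of Q {x} a" "comp_of Q {x} b" a b] x VQ ab by auto
    qed
    show "2 < card (pverts G)"
      using card_V k(2) by simp
    show "S \<subseteq> parcs Q"
      by (auto simp: S_def)
    show "U = {x, y}" if "(x, y) \<in> parcs Q" "(x, y) \<notin> S" for x y
      using that F(2) by (auto simp: S_def U_def)
    show "U = {} \<or> (\<exists>u w. U = {u, w} \<and> (u, w) \<in> parcs G)"
    proof (cases "F = {}")
      case False
      then have "U = f" "f \<in> edges Q"
        using F by (auto simp: U_def)
      then show ?thesis
        using QE by (auto simp: edges_def)
    qed (simp add: U_def)
    show "\<exists>X. GK.frag X \<and> x \<in> GK.nb X \<and> y \<in> GK.nb X" if "(x, y) \<in> S" for x y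
    proof -
      have xy: "(x, y) \<in> parcs Q" "\<not> k_contractible k G {x, y}"
        using that F(1) by (auto simp: S_def edges_def)
      then obtain T where T: "T \<subseteq> pverts G" "card T = k" "\<not> connected (delete_verts G T)" "x \<in> T" "y \<in> T"
        using noncontractible_separator[OF G kc card_V _ xy(2)] QE by blast
      then show ?thesis
        using separator_of_frag[OF G kc T(1-3)] by blast
    qed
    show "k \<le> 2 * card X + 1" if "GK.frag X" "(x, y) \<in> S" "x \<in> GK.nb X" "y \<in> GK.nb X" for X x y
    proof (rule big_S)
      have "{x, y} \<in> edges Q"
        using that(2) by (auto simp: S_def edges_def)
      then show "S_fragment G (edges Q) X"
        unfolding S_fragment_def T_S_fragment_def using frag_T[OF that(1)] that(3,4)
        by (intro exI[of _ "GK.nb X"] conjI bexI[of _ "{x, y}"]) simp_all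
    qed
    show "k \<le> 2 * card X + 1" if "U \<noteq> {}" "GK.frag X" for X
    proof (rule big)
      show "F \<noteq> {}"
        using that(1) by (auto simp: U_def)
      show "fragment G X"
        unfolding fragment_def using frag_T[OF that(2)] by (rule exI)
    qed
  qed
  show False
    by (rule covered_dfs_tree_false)
qed

theorem theorem9:
  fixes G Q :: "'a pair_pre_digraph" and r :: 'a and k :: nat
  assumes "pair_graph G"
    and "\<not> complete_digraph (card (pverts G)) (with_proj G)"
    and "connectivity G = k" and "k > 3"
    and "DFS_tree G Q r"
  defines "\<SS> \<equiv> edges Q"
  shows "((\<forall>F. S_fragment G \<SS> F \<longrightarrow> real (card F) \<ge> (real k - 1) / 2) \<longrightarrow>
            (\<exists>e\<in>edges Q. k_contractible k G e)) \<and>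
         ((\<forall>F. fragment G F \<longrightarrow> real (card F) \<ge> (real k - 1) / 2) \<longrightarrow>
            card {e \<in> edges Q. k_contractible k G e} \<ge> 2)"
proof -
  have half: "k \<le> 2 * n + 1" if "(real k - 1) / 2 \<le> real n" for n
  proof -
    have "real k \<le> real (2 * n + 1)"
      using that by simp
    then show ?thesis
      by (simp only: of_nat_le_iff)
  qed
  define F where "F = {e \<in> edges Q. k_contractible k G e}"
  note main = dfs_tree_at_most_one_contractible[OF assms(1-5) F_def]
  show ?thesis
  proof (intro conjI impI)
    assume h: "\<forall>X. S_fragment G \<SS> X \<longrightarrow> (real k - 1) / 2 \<le> real (card X)"
    show "\<exists>e\<in>edges Q. k_contractible k G e"
    proof (rule ccontr)
      assume "\<not> ?thesis"
      then have F: "F = {}"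
        by (auto simp: F_def)
      show False
      proof (rule main)
        \<comment> \<open>\<open>undefined\<close> is a dummy for \<open>f\<close>, since there is
          no exceptional edge.\<close>
        show "F = {} \<or> F = {undefined}"
          using F by simp
        show "k \<le> 2 * card X + 1" if "S_fragment G (edges Q) X" for X
          using h half that unfolding \<SS>_def by blast
      qed (use F in simp)
    qed
  next
    assume h: "\<forall>X. fragment G X \<longrightarrow> (real k - 1) / 2 \<le> real (card X)"
    show "2 \<le> card {e \<in> edges Q. k_contractible k G e}"
    proof (rule ccontr)
      assume "\<not> ?thesis"
      then have card: "card F = 0 \<or> card F = 1"
        by (auto simp: F_def)
      \<comment> \<open>Finiteness of \<open>F\<close> is needed to conclude from cardinality 0 that
        \<open>F\<close> is empty.\<close>
      have "pair_graph Q"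
        using assms(5) by (simp add: DFS_tree_def undirected_tree_def)
      then have "finite (pverts Q)" "parcs Q \<subseteq> pverts Q \<times> pverts Q"
        using pair_graph_basic by blast+
      then have "F \<subseteq> Pow (pverts Q)" "finite (Pow (pverts Q))"
        by (auto simp: F_def edges_def)
      then have "finite F"
        by (rule finite_subset)
      then have "\<exists>f. F = {} \<or> F = {f}"
        using card by (auto simp: card_1_singleton_iff)
      then obtain f where f: "F = {} \<or> F = {f}"
        by blast
      have big: "k \<le> 2 * card X + 1" if "fragment G X" for X
        using h half that by blast
      show False
      proof (rule main[OF f])
        show "k \<le> 2 * card X + 1" if "S_fragment G (edges Q) X" for X
        proof (rule big)
          show "fragment G X"
            using that by (auto simp: S_fragment_def T_S_fragment_def fragment_def)
        qed
        show "k \<le> 2 * card X + 1" if "fragment G X" for X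
          by (rule big[OF that])
      qed
    qed
  qed
qed

end
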